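(* Consider the regression model $y(x)=\theta^Tf(x)+\varepsilon(x)$, $x\in\mathcal X$, with covariance kernel $K$, a design $\xi\in\Xi$, and the corresponding vector-function $$g(x)=\int K(x,u)f(u)\,\xi(du)-\Lambda f(x),\quad x\in\mathcal X,\qquad \Lambda=B(\xi,\xi)M^{-1}(\xi).$$ (a) If $g(x)=0$ for all $x\in\mathcal X$, then the design $\xi$ is universally optimal. (b) If the design $\xi$ is universally optimal, then the function $g$ can be represented in the form $g(x)=\gamma(x)f(x)$, where $\gamma$ is a nonnegative function defined on $\mathcal X$ such that $\gamma(x)=0$ for all $x$ in the support of the design $\xi$.
   Context: $\mathcal X\subset\mathbb R^d$ is compact, $f=(f_1,\dots,f_m)^T$ has linearly independent continuous components with $f(x)\ne 0$ for all $x\in\mathcal X$, $\theta\in\mathbb R^m$ is unknown, and $\varepsilon$ has mean zero and covariance kernel $K$. The kernel $K$ is symmetric, continuous at all points $(u,v)\in\mathcal X\times\mathcal X$ except possibly at the diagonal points $(u,u)$, satisfies $K(u,v)\neq 0$ for at least one pair $u\ne v$, and is positive definite: $\iint K(u,v)\,\nu(du)\,\nu(dv)\ge 0$ for every signed measure $\nu$ on $\mathcal X$. Kernels with singularities at the diagonal are allowed; in that case $K(u,v)=r(u-v)$ with $0\le r(t)<\infty$ for $t\ne0$, $r(0)=+\infty$, and $r$ is the pointwise limit of a monotonously increasing sequence of covariance functions $\sigma_N^2\rho_N$ with $0\le\sigma_N^2\rho_N(t)\le r(t)$ for all $t$ and $N$. A design is a probability measure on $\mathcal X$. For designs $\xi,\nu$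 set $$M(\xi)=\int f(u)f^T(u)\,\xi(du),\quad B(\xi,\nu)=\iint K(u,v)f(u)f^T(v)\,\xi(du)\,\nu(dv),$$ $$D(\xi)=M^{-1}(\xi)B(\xi,\xi)M^{-1}(\xi),$$ provided that the corresponding integrals exist. $\Xi$ is the set of designs $\xi$ for which the matrices $B(\xi,\xi)$ and $M^{-1}(\xi)$ are well defined. A design $\xi^*$ is universally optimal if $D(\xi^* )\le D(\xi)$ in the sense of the Loewner ordering for any design $\xi\in\Xi$. The function $g$ is taken to be continuous on $\mathcal X$.
   Formalization: In (b), if K is infinite on the diagonal, it is additionally assumed that every neighbourhood in X of every point of X carries a design ν with B(ν,ν) finite; otherwise (b) can fail, e.g. at an isolated point of X, which no design in Ξ can charge. *)

theory Defs
  imports "HOL-Probability.Probability"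
begin

text \<open>
  Kernels take values in \<^typ>\<open>ereal\<close>, since they may be infinite on the diagonal.  An extended
  real function is integrable if it is measurable and its absolute value has a finite integral;
  it is then finite almost everywhere, so that passing to real values does not change the
  integral.  Products use the convention that 0 times infinity is 0.
\<close>

definition eintegrable :: "'a measure \<Rightarrow> ('a \<Rightarrow> ereal) \<Rightarrow> bool" where
  "eintegrable N F \<longleftrightarrow>
     F \<in> borel_measurable N \<and> (\<integral>\<^sup>+ x. e2ennreal \<bar>F x\<bar> \<partial>N) < \<infinity>"

definition eintegral :: "'a measure \<Rightarrow> ('a \<Rightarrow> ereal) \<Rightarrow> real" where
  "eintegral N F = (LINT x|N. real_of_ereal (F x))"

definition finite_borel_measure :: "'a::topological_space set \<Rightarrow> 'a measure \<Rightarrow> bool" where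
  "finite_borel_measure X P \<longleftrightarrow> finite_measure P \<and> sets P = sets (restrict_space borel X)"

definition design :: "'a::topological_space set \<Rightarrow> 'a measure \<Rightarrow> bool" where
  "design X \<xi> \<longleftrightarrow> prob_space \<xi> \<and> sets \<xi> = sets (restrict_space borel X)"

definition design_support :: "'a::topological_space set \<Rightarrow> 'a measure \<Rightarrow> 'a set" where
  "design_support X \<xi> = {x \<in> X. \<forall>U. open U \<and> x \<in> U \<longrightarrow> 0 < emeasure \<xi> (U \<inter> X)}"


subsection \<open>Covariance kernels\<close>

text \<open>
  By the Jordan decomposition the signed measures on \<open>X\<close> are the differences \<open>P - N\<close> of finite
  measures.  The double integral of \<open>K\<close> against \<open>P - N\<close> exists if \<open>K\<close> is integrable against the
  product of \<open>P + N\<close> with itself; its value then depends only on \<open>P - N\<close>.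
\<close>

definition double_integral_exists ::
  "('a \<Rightarrow> 'a \<Rightarrow> ereal) \<Rightarrow> 'a measure \<Rightarrow> 'a measure \<Rightarrow> bool" where
  "double_integral_exists K P N \<longleftrightarrow>
     (\<forall>Q\<in>{P, N}. \<forall>R\<in>{P, N}. eintegrable (Q \<Otimes>\<^sub>M R) (\<lambda>(u, v). K u v))"

definition double_integral ::
  "('a \<Rightarrow> 'a \<Rightarrow> ereal) \<Rightarrow> 'a measure \<Rightarrow> 'a measure \<Rightarrow> real" where
  "double_integral K P N =
     eintegral (P \<Otimes>\<^sub>M P) (\<lambda>(u, v). K u v) - eintegral (P \<Otimes>\<^sub>M N) (\<lambda>(u, v). K u v)
     - eintegral (N \<Otimes>\<^sub>M P) (\<lambda>(u, v). K u v) + eintegral (N \<Otimes>\<^sub>M N) (\<lambda>(u, v). K u v)"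

definition finite_kernel :: "'a set \<Rightarrow> ('a \<Rightarrow> 'a \<Rightarrow> ereal) \<Rightarrow> bool" where
  "finite_kernel X K \<longleftrightarrow> (\<forall>u\<in>X. \<forall>v\<in>X. \<bar>K u v\<bar> \<noteq> \<infinity>)"

text \<open>
  For a finite kernel the double integral is required to exist for every signed measure.  For a
  kernel that is infinite on the diagonal it does not exist for measures with atoms, and
  nonnegativity is required whenever it exists.
\<close>

definition positive_definite_kernel ::
  "'a::topological_space set \<Rightarrow> ('a \<Rightarrow> 'a \<Rightarrow> ereal) \<Rightarrow> bool" where
  "positive_definite_kernel X K \<longleftrightarrow>
     (\<forall>P N. finite_borel_measure X P \<and> finite_borel_measure X N \<longrightarrow>
        (finite_kernel X K \<longrightarrow> double_integral_exists K P N) \<and>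
        (double_integral_exists K P N \<longrightarrow> 0 \<le> double_integral K P N))"

definition correlation_function :: "('a::real_vector \<Rightarrow> real) \<Rightarrow> bool" where
  "correlation_function \<rho> \<longleftrightarrow>
     \<rho> 0 = 1 \<and> (\<forall>t. \<rho> (- t) = \<rho> t) \<and>
     (\<forall>S c. finite S \<longrightarrow> 0 \<le> (\<Sum>s\<in>S. \<Sum>t\<in>S. c s * c t * \<rho> (s - t)))"

definition singular_kernel ::
  "'a::real_vector set \<Rightarrow> ('a \<Rightarrow> 'a \<Rightarrow> ereal) \<Rightarrow> bool" where
  "singular_kernel X K \<longleftrightarrow>
     (\<exists>(r :: 'a \<Rightarrow> ereal) (\<sigma> :: nat \<Rightarrow> real) (\<rho> :: nat \<Rightarrow> 'a \<Rightarrow> real).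
        (\<forall>u\<in>X. \<forall>v\<in>X. K u v = r (u - v)) \<and>
        (\<forall>t. t \<noteq> 0 \<longrightarrow> 0 \<le> r t \<and> r t < \<infinity>) \<and> r 0 = \<infinity> \<and>
        (\<forall>N. correlation_function (\<rho> N)) \<and>
        (\<forall>t. mono (\<lambda>N. (\<sigma> N)\<^sup>2 * \<rho> N t)) \<and>
        (\<forall>t N. 0 \<le> (\<sigma> N)\<^sup>2 * \<rho> N t \<and> ereal ((\<sigma> N)\<^sup>2 * \<rho> N t) \<le> r t) \<and>
        (\<forall>t. (\<lambda>N. ereal ((\<sigma> N)\<^sup>2 * \<rho> N t)) \<longlonglongrightarrow> r t))"

definition covariance_kernel ::
  "'a::real_normed_vector set \<Rightarrow> ('a \<Rightarrow> 'a \<Rightarrow> ereal) \<Rightarrow> bool" where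
  "covariance_kernel X K \<longleftrightarrow>
     (\<forall>u\<in>X. \<forall>v\<in>X. K u v = K v u) \<and>
     (\<forall>u\<in>X. \<forall>v\<in>X. u \<noteq> v \<longrightarrow>
        continuous (at (u, v) within X \<times> X) (\<lambda>(x, y). K x y)) \<and>
     (\<exists>u\<in>X. \<exists>v\<in>X. u \<noteq> v \<and> K u v \<noteq> 0) \<and>
     positive_definite_kernel X K \<and>
     (finite_kernel X K \<or> singular_kernel X K)"


subsection \<open>Designs and their covariance matrices\<close>

definition linearly_independent_on :: "'a set \<Rightarrow> ('a \<Rightarrow> real ^ 'm) \<Rightarrow> bool" where
  "linearly_independent_on X f \<longleftrightarrow>
     (\<forall>c :: 'm \<Rightarrow> real. (\<forall>x\<in>X. (\<Sum>i\<in>UNIV. c i * f x $ i) = 0) \<longrightarrow> (\<forall>i. c i = 0))"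

definition M_matrix :: "('a \<Rightarrow> real ^ 'm) \<Rightarrow> 'a measure \<Rightarrow> real ^ 'm ^ 'm" where
  "M_matrix f \<xi> = (\<chi> i j. LINT u|\<xi>. f u $ i * f u $ j)"

definition B_exists ::
  "('a \<Rightarrow> 'a \<Rightarrow> ereal) \<Rightarrow> ('a \<Rightarrow> real ^ 'm) \<Rightarrow> 'a measure \<Rightarrow> 'a measure \<Rightarrow> bool" where
  "B_exists K f \<xi> \<nu> \<longleftrightarrow>
     (\<forall>i j. eintegrable (\<xi> \<Otimes>\<^sub>M \<nu>) (\<lambda>(u, v). K u v * ereal (f u $ i * f v $ j)))"

definition B_matrix ::
  "('a \<Rightarrow> 'a \<Rightarrow> ereal) \<Rightarrow> ('a \<Rightarrow> real ^ 'm) \<Rightarrow> 'a measure \<Rightarrow> 'a measure \<Rightarrow> real ^ 'm ^ 'm" where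
  "B_matrix K f \<xi> \<nu> =
     (\<chi> i j. eintegral (\<xi> \<Otimes>\<^sub>M \<nu>) (\<lambda>(u, v). K u v * ereal (f u $ i * f v $ j)))"

definition D_matrix ::
  "('a \<Rightarrow> 'a \<Rightarrow> ereal) \<Rightarrow> ('a \<Rightarrow> real ^ 'm) \<Rightarrow> 'a measure \<Rightarrow> real ^ 'm ^ 'm" where
  "D_matrix K f \<xi> =
     matrix_inv (M_matrix f \<xi>) ** B_matrix K f \<xi> \<xi> ** matrix_inv (M_matrix f \<xi>)"

definition admissible_designs ::
  "'a::topological_space set \<Rightarrow> ('a \<Rightarrow> 'a \<Rightarrow> ereal) \<Rightarrow> ('a \<Rightarrow> real ^ 'm) \<Rightarrow> 'a measure set" where
  "admissible_designs X K f =
     {\<xi>. design X \<xi> \<and> B_exists K f \<xi> \<xi> \<and> invertible (M_matrix f \<xi>)}"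

definition loewner_le :: "real ^ 'm ^ 'm \<Rightarrow> real ^ 'm ^ 'm \<Rightarrow> bool" where
  "loewner_le A C \<longleftrightarrow>
     transpose (C - A) = C - A \<and> (\<forall>z. 0 \<le> z \<bullet> ((C - A) *v z))"

definition universally_optimal ::
  "'a::topological_space set \<Rightarrow> ('a \<Rightarrow> 'a \<Rightarrow> ereal) \<Rightarrow> ('a \<Rightarrow> real ^ 'm) \<Rightarrow> 'a measure \<Rightarrow> bool" where
  "universally_optimal X K f \<xi> \<longleftrightarrow>
     \<xi> \<in> admissible_designs X K f \<and>
     (\<forall>\<nu>\<in>admissible_designs X K f. loewner_le (D_matrix K f \<xi>) (D_matrix K f \<nu>))"

definition Lambda_matrix ::
  "('a \<Rightarrow> 'a \<Rightarrow> ereal) \<Rightarrow> ('a \<Rightarrow> real ^ 'm) \<Rightarrow> 'a measure \<Rightarrow> real ^ 'm ^ 'm" where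
  "Lambda_matrix K f \<xi> = B_matrix K f \<xi> \<xi> ** matrix_inv (M_matrix f \<xi>)"

definition g_exists ::
  "'a set \<Rightarrow> ('a \<Rightarrow> 'a \<Rightarrow> ereal) \<Rightarrow> ('a \<Rightarrow> real ^ 'm) \<Rightarrow> 'a measure \<Rightarrow> bool" where
  "g_exists X K f \<xi> \<longleftrightarrow>
     (\<forall>x\<in>X. \<forall>i. eintegrable \<xi> (\<lambda>u. K x u * ereal (f u $ i)))"

definition g_function ::
  "('a \<Rightarrow> 'a \<Rightarrow> ereal) \<Rightarrow> ('a \<Rightarrow> real ^ 'm) \<Rightarrow> 'a measure \<Rightarrow> 'a \<Rightarrow> real ^ 'm" where
  "g_function K f \<xi> x =
     (\<chi> i. eintegral \<xi> (\<lambda>u. K x u * ereal (f u $ i))) - Lambda_matrix K f \<xi> *v f x"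

text \<open>
  If the kernel is infinite on the diagonal, a part of \<open>X\<close> may be invisible to all admissible
  designs: an isolated point, for instance, cannot carry mass.  The necessary condition for
  optimality says nothing about \<open>g\<close> on such a part, and the following condition rules it out.
  For finite kernels it always holds, as point masses are allowed.
\<close>

definition locally_chargeable ::
  "'a::topological_space set \<Rightarrow> ('a \<Rightarrow> 'a \<Rightarrow> ereal) \<Rightarrow> ('a \<Rightarrow> real ^ 'm) \<Rightarrow> bool" where
  "locally_chargeable X K f \<longleftrightarrow>
     (\<forall>x\<in>X. \<forall>U. open U \<and> x \<in> U \<longrightarrow>
        (\<exists>\<nu>. design X \<nu> \<and> B_exists K f \<nu> \<nu> \<and> emeasure \<nu> (U \<inter> X) = 1))"

end

theory Submission
  imports Defs
begin

text \<open>
  For a vector \<open>x\<close>, the quadratic form of \<open>B(\<xi>, \<xi>)\<close> at \<open>x\<close> is the energy of the signed measure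
  with density \<open>x \<bullet> f\<close> with respect to \<open>\<xi>\<close>, and \<open>z \<bullet> D(\<xi>) z\<close> is this energy at
  \<open>x = M(\<xi>)\<^sup>-\<^sup>1 z\<close>.  By Fubini \<open>B(\<xi>, \<nu>) = \<integral> g f\<^sup>T d\<nu> + \<Lambda> M(\<nu>)\<close>.  If \<open>g = 0\<close>, the mixed energy of
  \<open>\<xi>\<close> and \<open>\<nu>\<close> equals the energy of \<open>\<xi>\<close>, so that \<open>z \<bullet> (D(\<nu>) - D(\<xi>)) z\<close> is the energy of a
  difference and hence nonnegative.  Conversely, the directional derivative of \<open>D\<close> at an optimal \<open>\<xi>\<close>
  shows that \<open>\<integral> (w \<bullet> g) (w \<bullet> f) d\<nu> \<ge> 0\<close> for all \<open>w\<close> and \<open>\<nu>\<close>.  Concentrating \<open>\<nu>\<close> near a point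
  makes \<open>w \<bullet> g(x)\<close> and \<open>w \<bullet> f(x)\<close> agree in sign for all \<open>w\<close>, which forces
  \<open>g(x) = \<gamma>(x) f(x)\<close> with \<open>\<gamma>(x) \<ge> 0\<close>; the support condition follows from
  \<open>\<integral> g f\<^sup>T d\<xi> = B(\<xi>, \<xi>) - \<Lambda> M(\<xi>) = 0\<close>.

  All energies are computed as integrals against one probability measure \<open>\<omega>\<close> that dominates both
  designs, so that signed measures and mixtures of designs become densities.
\<close>


subsection \<open>Energies of signed measures\<close>

text \<open>For infinite \<open>x\<close> both sides are infinite if \<open>c \<noteq> 0\<close> and
  zero if \<open>c = 0\<close>, because 0 times infinity is 0.\<close>

lemma e2ennreal_abs_mult:
  "e2ennreal \<bar>x * ereal c\<bar> = e2ennreal \<bar>x\<bar> * ennreal \<bar>c\<bar>"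
proof (cases x)
  case (real r)
  then show ?thesis by (simp add: abs_mult ennreal_mult)
qed (auto simp: ereal_abs_mult ennreal_top_mult ennreal_eq_0_iff)

text \<open>\<open>real_of_ereal\<close> sends infinite values to 0, hence an inequality rather than
  an equation.\<close>

lemma e2ennreal_abs_real:
  "ennreal \<bar>real_of_ereal x\<bar> \<le> e2ennreal \<bar>x\<bar>"
  by (cases x) auto

text \<open>Measurability of the kernel is an assumption at this level because its proof differs for
  finite and for singular kernels; see \<open>kernel_on_space_design\<close>.\<close>

locale kernel_on_space = finite_measure \<omega>
  for X :: "'a::topological_space set" and K :: "'a \<Rightarrow> 'a \<Rightarrow> ereal" and \<omega> :: "'a measure" +
  assumes sets_omega: "sets \<omega> = sets (restrict_space borel X)"
    and kernel_measurable [measurable]: "(\<lambda>z. K (fst z) (snd z)) \<in> borel_measurable (\<omega> \<Otimes>\<^sub>M \<omega>)"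
    and kernel_sym: "\<And>u v. u \<in> X \<Longrightarrow> v \<in> X \<Longrightarrow> K u v = K v u"
    and kernel_pd: "positive_definite_kernel X K"
begin

section \<open>Integrability and bilinearity of the energy form\<close>

lemma space_omega: "space \<omega> = X"
  using sets_eq_imp_space_eq[OF sets_omega] by (simp add: space_restrict_space)

sublocale P: pair_sigma_finite \<omega> \<omega> ..

text \<open>Extended values are kept here, so that an infinite value of \<open>K\<close> counts
  wherever the weight is nonzero. Under this condition the real values used in
  \<open>kernel_form\<close> differ from the extended ones only where the weight vanishes or on a
  null set.\<close>

definition kernel_integrable :: "('a \<Rightarrow> real) \<Rightarrow> ('a \<Rightarrow> real) \<Rightarrow> bool" where
  "kernel_integrable p q \<longleftrightarrow>
     (\<integral>\<^sup>+z. e2ennreal \<bar>K (fst z) (snd z)\<bar> * ennreal \<bar>p (fst z) * q (snd z)\<bar> \<partial>(\<omega> \<Otimes>\<^sub>M \<omega>)) < \<infinity>"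

definition kernel_form :: "('a \<Rightarrow> real) \<Rightarrow> ('a \<Rightarrow> real) \<Rightarrow> real" where
  "kernel_form p q =
     (LINT z|(\<omega> \<Otimes>\<^sub>M \<omega>). real_of_ereal (K (fst z) (snd z)) * (p (fst z) * q (snd z)))"

lemma integrable_kernel_form:
  assumes [measurable]: "p \<in> borel_measurable \<omega>" "q \<in> borel_measurable \<omega>"
    and "kernel_integrable p q"
  shows "integrable (\<omega> \<Otimes>\<^sub>M \<omega>)
           (\<lambda>z. real_of_ereal (K (fst z) (snd z)) * (p (fst z) * q (snd z)))"
proof (rule integrableI_bounded)
  have "(\<integral>\<^sup>+z. norm (real_of_ereal (K (fst z) (snd z)) * (p (fst z) * q (snd z))) \<partial>(\<omega> \<Otimes>\<^sub>M \<omega>))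
    \<le> (\<integral>\<^sup>+z. e2ennreal \<bar>K (fst z) (snd z)\<bar> * ennreal \<bar>p (fst z) * q (snd z)\<bar> \<partial>(\<omega> \<Otimes>\<^sub>M \<omega>))"
    unfolding real_norm_def abs_mult[of "real_of_ereal _"]
    by (intro nn_integral_mono) (simp add: ennreal_mult mult_right_mono e2ennreal_abs_real
        del: abs_real_of_ereal)
  also have "\<dots> < \<infinity>"
    using assms(3) by (simp add: kernel_integrable_def)
  finally show "(\<integral>\<^sup>+z. norm (real_of_ereal (K (fst z) (snd z)) * (p (fst z) * q (snd z)))
      \<partial>(\<omega> \<Otimes>\<^sub>M \<omega>)) < \<infinity>" .
qed measurable

lemma kernel_integrable_commute:
  assumes [measurable]: "p \<in> borel_measurable \<omega>" "q \<in> borel_measurable \<omega>"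
  shows "kernel_integrable p q \<longleftrightarrow> kernel_integrable q p"
proof -
  let ?F = "\<lambda>p q z. e2ennreal \<bar>K (fst z) (snd z)\<bar> * ennreal \<bar>p (fst z) * q (snd z)\<bar>"
  have "(\<integral>\<^sup>+z. ?F p q z \<partial>(\<omega> \<Otimes>\<^sub>M \<omega>)) = (\<integral>\<^sup>+x. \<integral>\<^sup>+y. ?F p q (x, y) \<partial>\<omega> \<partial>\<omega>)"
    by (rule nn_integral_fst[where f = "?F p q", symmetric]) measurable
  also have "\<dots> = (\<integral>\<^sup>+x. \<integral>\<^sup>+y. ?F q p (y, x) \<partial>\<omega> \<partial>\<omega>)"
    by (intro nn_integral_cong) (simp add: space_omega kernel_sym mult.commute)
  also have "\<dots> = (\<integral>\<^sup>+z. ?F q p z \<partial>(\<omega> \<Otimes>\<^sub>M \<omega>))"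
    by (rule P.nn_integral_snd[where f = "?F q p"]) measurable
  finally show ?thesis
    by (simp add: kernel_integrable_def)
qed

lemma kernel_form_commute:
  assumes [measurable]: "p \<in> borel_measurable \<omega>" "q \<in> borel_measurable \<omega>"
  shows "kernel_form p q = kernel_form q p"
proof -
  let ?F = "\<lambda>p q z. real_of_ereal (K (fst z) (snd z)) * (p (fst z) * q (snd z))"
  have "kernel_form p q = (\<integral>(x, y). ?F p q (y, x) \<partial>(\<omega> \<Otimes>\<^sub>M \<omega>))"
    unfolding kernel_form_def by (rule P.integral_product_swap[symmetric]) measurable
  also have "\<dots> = kernel_form q p"
    unfolding kernel_form_def
    by (rule Bochner_Integration.integral_cong)
      (auto simp: space_pair_measure space_omega kernel_sym mult.commute)
  finally show ?thesis .
qed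

lemma kernel_integrable_mono:
  assumes "kernel_integrable p q"
    and "\<And>x. x \<in> X \<Longrightarrow> \<bar>p' x\<bar> \<le> \<bar>p x\<bar>" "\<And>x. x \<in> X \<Longrightarrow> \<bar>q' x\<bar> \<le> \<bar>q x\<bar>"
  shows "kernel_integrable p' q'"
  unfolding kernel_integrable_def
  using assms
  by (intro le_less_trans[OF nn_integral_mono assms(1)[unfolded kernel_integrable_def]])
    (auto simp: abs_mult space_pair_measure space_omega intro!: mult_left_mono ennreal_leI mult_mono)

lemma kernel_integrable_add:
  assumes [measurable]: "p \<in> borel_measurable \<omega>" "p' \<in> borel_measurable \<omega>" "q \<in> borel_measurable \<omega>"
    and "kernel_integrable p q" "kernel_integrable p' q"
  shows "kernel_integrable (\<lambda>x. p x + p' x) q"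
proof -
  let ?F = "\<lambda>p q z. e2ennreal \<bar>K (fst z) (snd z)\<bar> * ennreal \<bar>p (fst z) * q (snd z)\<bar>"
  have "(\<integral>\<^sup>+z. ?F (\<lambda>x. p x + p' x) q z \<partial>(\<omega> \<Otimes>\<^sub>M \<omega>)) \<le> (\<integral>\<^sup>+z. ?F p q z + ?F p' q z \<partial>(\<omega> \<Otimes>\<^sub>M \<omega>))"
  proof (rule nn_integral_mono)
    fix z
    have "ennreal \<bar>(p (fst z) + p' (fst z)) * q (snd z)\<bar>
        \<le> ennreal (\<bar>p (fst z) * q (snd z)\<bar> + \<bar>p' (fst z) * q (snd z)\<bar>)"
      by (intro ennreal_leI) (metis abs_triangle_ineq distrib_right)
    then show "?F (\<lambda>x. p x + p' x) q z \<le> ?F p q z + ?F p' q z"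
      by (simp add: distrib_left[symmetric] mult_left_mono)
  qed
  also have "\<dots> < \<infinity>"
    using assms(4,5) by (subst nn_integral_add) (auto simp: kernel_integrable_def)
  finally show ?thesis
    by (simp add: kernel_integrable_def)
qed

lemma kernel_integrable_cmult:
  assumes [measurable]: "p \<in> borel_measurable \<omega>" "q \<in> borel_measurable \<omega>"
    and "kernel_integrable p q"
  shows "kernel_integrable (\<lambda>x. c * p x) q"
proof -
  have "(\<integral>\<^sup>+z. e2ennreal \<bar>K (fst z) (snd z)\<bar> * ennreal \<bar>c * p (fst z) * q (snd z)\<bar> \<partial>(\<omega> \<Otimes>\<^sub>M \<omega>))
      = ennreal \<bar>c\<bar> * (\<integral>\<^sup>+z. e2ennreal \<bar>K (fst z) (snd z)\<bar> * ennreal \<bar>p (fst z) * q (snd z)\<bar> \<partial>(\<omega> \<Otimes>\<^sub>M \<omega>))"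
    by (subst nn_integral_cmult[symmetric])
      (auto simp: abs_mult ennreal_mult ac_simps intro!: nn_integral_cong)
  then show ?thesis
    using assms(3) by (simp add: kernel_integrable_def ennreal_mult_less_top)
qed

lemma kernel_integrable_sum:
  assumes "finite I" and [measurable]: "\<And>i. i \<in> I \<Longrightarrow> p i \<in> borel_measurable \<omega>" "q \<in> borel_measurable \<omega>"
    and "\<And>i. i \<in> I \<Longrightarrow> kernel_integrable (p i) q"
  shows "kernel_integrable (\<lambda>x. \<Sum>i\<in>I. p i x) q"
  using assms(1,2,4)
proof (induction I rule: finite_induct)
  case empty
  then show ?case by (simp add: kernel_integrable_def)
next
  case (insert i I)
  then show ?case
    by (simp, intro kernel_integrable_add assms(3)) auto
qed

lemma kernel_form_add:
  assumes "p \<in> borel_measurable \<omega>" "p' \<in> borel_measurable \<omega>" "q \<in> borel_measurable \<omega>"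
    and "kernel_integrable p q" "kernel_integrable p' q"
  shows "kernel_form (\<lambda>x. p x + p' x) q = kernel_form p q + kernel_form p' q"
  unfolding kernel_form_def distrib_left distrib_right
  using assms by (intro Bochner_Integration.integral_add integrable_kernel_form)

lemma kernel_form_cmult: "kernel_form (\<lambda>x. c * p x) q = c * kernel_form p q"
  unfolding kernel_form_def
  by (subst integral_mult_right_zero[symmetric]) (simp add: ac_simps)

lemma kernel_form_sum:
  assumes "finite I" "\<And>i. i \<in> I \<Longrightarrow> p i \<in> borel_measurable \<omega>" "q \<in> borel_measurable \<omega>"
    and "\<And>i. i \<in> I \<Longrightarrow> kernel_integrable (p i) q"
  shows "kernel_form (\<lambda>x. \<Sum>i\<in>I. p i x) q = (\<Sum>i\<in>I. kernel_form (p i) q)"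
  unfolding kernel_form_def using assms
  by (subst Bochner_Integration.integral_sum[symmetric])
    (auto intro!: integrable_kernel_form simp: sum_distrib_left sum_distrib_right)

section \<open>Measures with densities and positivity of their energies\<close>

lemma finite_borel_measure_density:
  assumes [measurable]: "p \<in> borel_measurable \<omega>" and "integrable \<omega> p"
  shows "finite_borel_measure X (density \<omega> p)"
  unfolding finite_borel_measure_def
proof
  show "finite_measure (density \<omega> p)"
  proof
    have "emeasure (density \<omega> p) (space \<omega>) = (\<integral>\<^sup>+x. ennreal (p x) \<partial>\<omega>)"
      by (simp add: emeasure_density cong: nn_integral_cong)
    also have "\<dots> \<le> (\<integral>\<^sup>+x. norm (p x) \<partial>\<omega>)"
      by (intro nn_integral_mono ennreal_leI) auto
    also have "\<dots> < \<infinity>"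
      using assms(2) by (simp add: integrable_iff_bounded)
    finally show "emeasure (density \<omega> p) (space (density \<omega> p)) \<noteq> \<infinity>" by simp
  qed
  show "sets (density \<omega> p) = sets (restrict_space borel X)"
    by (simp add: sets_omega)
qed

lemma pair_measure_density_omega:
  assumes [measurable]: "p \<in> borel_measurable \<omega>" "q \<in> borel_measurable \<omega>"
    and nonneg: "\<And>x. 0 \<le> p x" "\<And>x. 0 \<le> q x" and fin: "finite_measure (density \<omega> q)"
  shows "density \<omega> p \<Otimes>\<^sub>M density \<omega> q
    = density (\<omega> \<Otimes>\<^sub>M \<omega>) (\<lambda>z. ennreal (p (fst z) * q (snd z)))"
proof -
  interpret Q: finite_measure "density \<omega> q" by fact
  show ?thesis
    using nonneg
    by (subst pair_measure_density)
      (auto simp: ennreal_mult split_beta' intro!: sigma_finite_measure Q.sigma_finite_measure)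
qed

text \<open>The product of the two measures has density \<open>a u * b v\<close> with respect to
  \<open>\<omega> \<Otimes>\<^sub>M \<omega>\<close>, so the densities are absorbed into
  \<open>p\<close> and \<open>q\<close>. The case \<open>p = q = 1\<close> concerns the kernel
  alone, other cases the entries of \<open>B\<close>.\<close>

lemma eintegrable_density_iff:
  assumes [measurable]: "a \<in> borel_measurable \<omega>" "b \<in> borel_measurable \<omega>"
      "p \<in> borel_measurable \<omega>" "q \<in> borel_measurable \<omega>"
    and nonneg: "\<And>x. 0 \<le> a x" "\<And>x. 0 \<le> b x" and fin: "finite_measure (density \<omega> b)"
  shows "eintegrable (density \<omega> a \<Otimes>\<^sub>M density \<omega> b) (\<lambda>(u, v). K u v * ereal (p u * q v))
    \<longleftrightarrow> kernel_integrable (\<lambda>x. p x * a x) (\<lambda>x. q x * b x)"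
proof -
  have "(\<integral>\<^sup>+z. e2ennreal \<bar>K (fst z) (snd z) * ereal (p (fst z) * q (snd z))\<bar>
        \<partial>density (\<omega> \<Otimes>\<^sub>M \<omega>) (\<lambda>z. ennreal (a (fst z) * b (snd z))))
      = (\<integral>\<^sup>+z. e2ennreal \<bar>K (fst z) (snd z)\<bar>
          * ennreal \<bar>(p (fst z) * a (fst z)) * (q (snd z) * b (snd z))\<bar> \<partial>(\<omega> \<Otimes>\<^sub>M \<omega>))"
    using nonneg
    by (subst nn_integral_density)
      (auto simp: e2ennreal_abs_mult abs_mult ennreal_mult ac_simps intro!: nn_integral_cong)
  then show ?thesis
    using assms
    by (simp add: pair_measure_density_omega eintegrable_def kernel_integrable_def split_beta')
qed

lemma eintegral_density:
  assumes [measurable]: "a \<in> borel_measurable \<omega>" "b \<in> borel_measurable \<omega>"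
      "p \<in> borel_measurable \<omega>" "q \<in> borel_measurable \<omega>"
    and nonneg: "\<And>x. 0 \<le> a x" "\<And>x. 0 \<le> b x" and fin: "finite_measure (density \<omega> b)"
  shows "eintegral (density \<omega> a \<Otimes>\<^sub>M density \<omega> b) (\<lambda>(u, v). K u v * ereal (p u * q v))
    = kernel_form (\<lambda>x. p x * a x) (\<lambda>x. q x * b x)"
  using assms
  by (simp add: pair_measure_density_omega eintegral_def kernel_form_def split_beta'
      integral_density ac_simps)

text \<open>
  A function \<open>p\<close> is the density of a signed measure whose Jordan decomposition has the densities
  \<open>max 0 p\<close> and \<open>max 0 (-p)\<close>.
\<close>

lemma kernel_form_nonneg:
  assumes p [measurable]: "p \<in> borel_measurable \<omega>" and "integrable \<omega> p"
    and ki: "kernel_integrable p p"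
  shows "0 \<le> kernel_form p p"
proof -
  define p1 where "p1 x = max 0 (p x)" for x
  define p2 where "p2 x = max 0 (- p x)" for x
  have m [measurable]: "p1 \<in> borel_measurable \<omega>" "p2 \<in> borel_measurable \<omega>"
    by (auto simp: p1_def p2_def [abs_def] p1_def [abs_def])
  have nn: "\<And>x. 0 \<le> p1 x" "\<And>x. 0 \<le> p2 x"
    by (auto simp: p1_def p2_def)
  have i: "integrable \<omega> p1" "integrable \<omega> p2"
    using assms(2) by (auto simp: p1_def [abs_def] p2_def [abs_def])
  have fb: "finite_borel_measure X (density \<omega> p1)" "finite_borel_measure X (density \<omega> p2)"
    by (intro finite_borel_measure_density m i)+
  then have fin: "finite_measure (density \<omega> p1)" "finite_measure (density \<omega> p2)"
    by (auto simp: finite_borel_measure_def)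
  have le: "\<bar>p1 x\<bar> \<le> \<bar>p x\<bar>" "\<bar>p2 x\<bar> \<le> \<bar>p x\<bar>" for x
    by (auto simp: p1_def p2_def)
  have kis: "kernel_integrable p1 p1" "kernel_integrable p1 p2"
      "kernel_integrable p2 p1" "kernel_integrable p2 p2"
    by (rule kernel_integrable_mono[OF ki]; rule le)+
  note conv = eintegrable_density_iff[where p = "\<lambda>_. 1" and q = "\<lambda>_. 1", simplified]
    eintegral_density[where p = "\<lambda>_. 1" and q = "\<lambda>_. 1", simplified]
  have "double_integral_exists K (density \<omega> p1) (density \<omega> p2)"
    unfolding double_integral_exists_def using kis fin nn m by (simp add: conv)
  then have "0 \<le> double_integral K (density \<omega> p1) (density \<omega> p2)"
    using kernel_pd fb unfolding positive_definite_kernel_def by blast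
  also have "\<dots> = kernel_form p1 p1 - kernel_form p1 p2 - kernel_form p2 p1 + kernel_form p2 p2"
    unfolding double_integral_def using fin nn m by (simp add: conv)
  also have "\<dots> = kernel_form p p"
  proof -
    have "p = (\<lambda>x. p1 x + (-1) * p2 x)"
      by (auto simp: p1_def p2_def fun_eq_iff)
    \<comment> \<open>Linearity in the first argument is used twice; symmetry of the form transfers
      it to the second argument in between.\<close>
    have *: "kernel_form p q = kernel_form p1 q - kernel_form p2 q"
      if "kernel_integrable p1 q" "kernel_integrable p2 q" and [measurable]: "q \<in> borel_measurable \<omega>" for q
      using that kernel_form_add[of p1 "\<lambda>x. (-1) * p2 x" q] kernel_integrable_cmult[of p2 q "-1"]
        kernel_form_cmult[of "-1" p2 q]
      by (subst \<open>p = _\<close>) simp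
    have "kernel_integrable p1 p" "kernel_integrable p2 p"
      by (rule kernel_integrable_mono[OF ki]; simp add: le)+
    then have "kernel_form p p = kernel_form p p1 - kernel_form p p2"
      by (simp add: * kernel_form_commute[of p])
    then show ?thesis
      using kis by (simp add: * )
  qed
  finally show ?thesis .
qed

text \<open>Linearity in the first argument and symmetry expand the square. The coefficients 1 and
  -1 serve the truncation argument for mixed integrals, 1 and 1 the positivity of \<open>B\<close>,
  and \<open>1 - t\<close> and \<open>t\<close> the mixtures of designs.\<close>

lemma kernel_form_square:
  assumes [measurable]: "p \<in> borel_measurable \<omega>" "q \<in> borel_measurable \<omega>"
    and "kernel_integrable p p" "kernel_integrable p q" "kernel_integrable q q"
  shows "kernel_integrable (\<lambda>x. c * p x + d * q x) (\<lambda>x. c * p x + d * q x)"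
    and "kernel_form (\<lambda>x. c * p x + d * q x) (\<lambda>x. c * p x + d * q x)
      = c\<^sup>2 * kernel_form p p + 2 * c * d * kernel_form p q + d\<^sup>2 * kernel_form q q"
proof -
  let ?h = "\<lambda>x. c * p x + d * q x"
  have qp: "kernel_integrable q p"
    using assms by (simp add: kernel_integrable_commute)
  have hi: "kernel_integrable ?h r"
    and hf: "kernel_form ?h r = c * kernel_form p r + d * kernel_form q r"
    if [measurable]: "r \<in> borel_measurable \<omega>" and "kernel_integrable p r" "kernel_integrable q r" for r
    using that by (simp_all add: kernel_integrable_add kernel_integrable_cmult
        kernel_form_add kernel_form_cmult)
  have ph: "kernel_integrable p ?h" "kernel_integrable q ?h"
    using hi[of p] hi[of q] assms qp by (simp_all add: kernel_integrable_commute[of _ ?h])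
  then show "kernel_integrable ?h ?h"
    by (simp add: hi)
  have "kernel_form ?h ?h = c * kernel_form ?h p + d * kernel_form ?h q"
    using ph by (simp add: hf kernel_form_commute[of _ ?h])
  also have "\<dots> = c\<^sup>2 * kernel_form p p + 2 * c * d * kernel_form p q + d\<^sup>2 * kernel_form q q"
    using assms qp by (simp add: hf kernel_form_commute[of q p] algebra_simps power2_eq_square)
  finally show "kernel_form ?h ?h
      = c\<^sup>2 * kernel_form p p + 2 * c * d * kernel_form p q + d\<^sup>2 * kernel_form q q" .
qed

text \<open>For a finite kernel, positive definiteness includes the existence of every double
  integral. It is applied to the measures with densities \<open>\<bar>p\<bar>\<close> and
  \<open>\<bar>q\<bar>\<close>, whose mixed term is the integral in question.\<close>

lemma kernel_integrable_finite_kernel: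
  assumes [measurable]: "p \<in> borel_measurable \<omega>" "q \<in> borel_measurable \<omega>"
    and "integrable \<omega> p" "integrable \<omega> q" and "finite_kernel X K"
  shows "kernel_integrable p q"
proof -
  let ?p = "\<lambda>x. \<bar>p x\<bar>" and ?q = "\<lambda>x. \<bar>q x\<bar>"
  have fb: "finite_borel_measure X (density \<omega> ?p)" "finite_borel_measure X (density \<omega> ?q)"
    using assms by (auto intro!: finite_borel_measure_density)
  then have "double_integral_exists K (density \<omega> ?p) (density \<omega> ?q)"
    using kernel_pd \<open>finite_kernel X K\<close> by (auto simp: positive_definite_kernel_def)
  then have "eintegrable (density \<omega> ?p \<Otimes>\<^sub>M density \<omega> ?q) (\<lambda>(u, v). K u v)"
    by (auto simp: double_integral_exists_def)
  then have "kernel_integrable ?p ?q"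
    using fb eintegrable_density_iff[of ?p ?q "\<lambda>_. 1" "\<lambda>_. 1"]
    by (simp add: finite_borel_measure_def)
  then show ?thesis
    by (rule kernel_integrable_mono) auto
qed

lemma nn_integral_eq_kernel_form:
  assumes [measurable]: "p \<in> borel_measurable \<omega>" "q \<in> borel_measurable \<omega>"
    and nn: "\<And>x. 0 \<le> p x" "\<And>x. 0 \<le> q x" "\<And>u v. u \<in> X \<Longrightarrow> v \<in> X \<Longrightarrow> 0 \<le> K u v"
    and ki: "kernel_integrable p q"
  shows "(\<integral>\<^sup>+z. e2ennreal \<bar>K (fst z) (snd z)\<bar> * ennreal \<bar>p (fst z) * q (snd z)\<bar> \<partial>(\<omega> \<Otimes>\<^sub>M \<omega>))
    = ennreal (kernel_form p q)"
proof -
  let ?W = "\<lambda>z. e2ennreal \<bar>K (fst z) (snd z)\<bar> * ennreal \<bar>p (fst z) * q (snd z)\<bar>"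
  let ?k = "\<lambda>z. real_of_ereal (K (fst z) (snd z)) * (p (fst z) * q (snd z))"
  have pos: "0 \<le> ?k z" if "z \<in> space (\<omega> \<Otimes>\<^sub>M \<omega>)" for z
    using that nn
    by (auto simp: space_pair_measure space_omega intro!: mult_nonneg_nonneg real_of_ereal_pos)
  have ae: "AE z in \<omega> \<Otimes>\<^sub>M \<omega>. ?W z \<noteq> \<infinity>"
    using ki by (intro nn_integral_PInf_AE) (auto simp: kernel_integrable_def)
  \<comment> \<open>If \<open>K\<close> is infinite where \<open>?W\<close> is finite, the weight
    vanishes there and both sides are 0.\<close>
  have eq: "?W z = ennreal (?k z)" if "z \<in> space (\<omega> \<Otimes>\<^sub>M \<omega>)" "?W z \<noteq> \<infinity>" for z
  proof (cases "K (fst z) (snd z)")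
    case (real r)
    then have "0 \<le> r"
      using nn(3)[of "fst z" "snd z"] that(1) by (auto simp: space_pair_measure space_omega)
    then show ?thesis
      using real nn by (simp add: ennreal_mult)
  qed (use that in \<open>auto simp: ennreal_top_mult ennreal_eq_0_iff split: if_splits\<close>)
  have "AE z in \<omega> \<Otimes>\<^sub>M \<omega>. ?W z = ennreal (?k z)"
    using ae AE_space by eventually_elim (rule eq)
  then have "(\<integral>\<^sup>+z. ?W z \<partial>(\<omega> \<Otimes>\<^sub>M \<omega>)) = (\<integral>\<^sup>+z. ennreal (?k z) \<partial>(\<omega> \<Otimes>\<^sub>M \<omega>))"
    by (rule nn_integral_cong_AE)
  also have "\<dots> = ennreal (kernel_form p q)"
    unfolding kernel_form_def using pos
    by (intro nn_integral_eq_integral integrable_kernel_form ki) auto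
  finally show ?thesis .
qed

text \<open>
  Truncating \<open>q\<close> to the set where the potential \<open>H\<close> of \<open>p\<close> is at most \<open>n\<close> makes the mixed integral
  finite, and then positive definiteness bounds it independently of \<open>n\<close>.
\<close>

lemma kernel_integrable_mixed:
  assumes [measurable]: "p \<in> borel_measurable \<omega>" "q \<in> borel_measurable \<omega>"
    and "integrable \<omega> p" "integrable \<omega> q"
    and nn: "\<And>x. 0 \<le> p x" "\<And>x. 0 \<le> q x" "\<And>u v. u \<in> X \<Longrightarrow> v \<in> X \<Longrightarrow> 0 \<le> K u v"
    and pp: "kernel_integrable p p" and qq: "kernel_integrable q q"
    and potential: "\<And>v. v \<in> X \<Longrightarrow> (\<integral>\<^sup>+u. e2ennreal \<bar>K v u\<bar> * ennreal (p u) \<partial>\<omega>) < \<infinity>"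
  shows "kernel_integrable q p"
proof -
  define H where "H v = (\<integral>\<^sup>+u. e2ennreal \<bar>K v u\<bar> * ennreal (p u) \<partial>\<omega>)" for v
  have [measurable]: "case_prod K \<in> borel_measurable (\<omega> \<Otimes>\<^sub>M \<omega>)"
    using kernel_measurable by (simp add: split_beta')
  have H [measurable]: "H \<in> borel_measurable \<omega>"
    unfolding H_def [abs_def] by measurable
  \<comment> \<open>By Tonelli, a mixed integral with \<open>p\<close> is the integral of the
    potential \<open>H\<close>.\<close>
  have iter: "(\<integral>\<^sup>+z. e2ennreal \<bar>K (fst z) (snd z)\<bar> * ennreal \<bar>r (fst z) * p (snd z)\<bar> \<partial>(\<omega> \<Otimes>\<^sub>M \<omega>))
      = (\<integral>\<^sup>+v. H v * ennreal (r v) \<partial>\<omega>)"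
    if [measurable]: "r \<in> borel_measurable \<omega>" and "\<And>x. 0 \<le> r x" for r
  proof -
    have "(\<integral>\<^sup>+z. e2ennreal \<bar>K (fst z) (snd z)\<bar> * ennreal \<bar>r (fst z) * p (snd z)\<bar> \<partial>(\<omega> \<Otimes>\<^sub>M \<omega>))
        = (\<integral>\<^sup>+v. \<integral>\<^sup>+u. e2ennreal \<bar>K v u\<bar> * ennreal \<bar>r v * p u\<bar> \<partial>\<omega> \<partial>\<omega>)"
      by (subst nn_integral_fst[symmetric]) auto
    also have "\<dots> = (\<integral>\<^sup>+v. H v * ennreal (r v) \<partial>\<omega>)"
      unfolding H_def using that nn
      by (intro nn_integral_cong, subst nn_integral_multc[symmetric])
        (auto simp: ennreal_mult abs_mult ac_simps intro!: nn_integral_cong)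
    finally show ?thesis .
  qed
  define Q where "Q n v = q v * indicator {v \<in> space \<omega>. H v \<le> of_nat n} v" for n :: nat and v
  have Q [measurable]: "Q n \<in> borel_measurable \<omega>" for n
    unfolding Q_def [abs_def] by measurable
  have Q_nn: "0 \<le> Q n x" and Q_le: "Q n x \<le> q x" for n x
    using nn(2) by (auto simp: Q_def indicator_def)
  have Q_int: "integrable \<omega> (Q n)" for n
    using Q_nn by (intro Bochner_Integration.integrable_bound[OF assms(4)])
      (auto intro: order_trans[OF Q_le abs_ge_self])
  have QQ: "kernel_integrable (Q n) (Q n)" for n
    using Q_nn Q_le by (intro kernel_integrable_mono[OF qq]) (auto simp: nn)
  have Qp: "kernel_integrable (Q n) p" for n
  proof -
    have "(\<integral>\<^sup>+v. H v * ennreal (Q n v) \<partial>\<omega>) \<le> (\<integral>\<^sup>+v. of_nat n * ennreal (q v) \<partial>\<omega>)"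
      by (intro nn_integral_mono) (auto simp: Q_def indicator_def intro!: mult_right_mono)
    also have "\<dots> < \<infinity>"
      using assms(4) nn(2)
      by (simp add: nn_integral_cmult integrable_iff_bounded ennreal_mult_less_top of_nat_less_top)
    finally show ?thesis
      by (simp add: kernel_integrable_def iter Q Q_nn)
  qed
  \<comment> \<open>The energy of \<open>p - Q n\<close> is nonnegative, so twice the mixed term is
    at most the sum of the energies of \<open>p\<close> and \<open>Q n\<close>; since
    \<open>K\<close> is nonnegative, the latter is at most the energy of \<open>q\<close>.\<close>
  define C where "C = (kernel_form p p + kernel_form q q) / 2"
  have "(\<integral>\<^sup>+v. H v * ennreal (Q n v) \<partial>\<omega>) \<le> ennreal C" for n
  proof -
    have pQ: "kernel_integrable p (Q n)"
      using Qp by (simp add: kernel_integrable_commute)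
    note sq = kernel_form_square[OF assms(1) Q pp pQ QQ, of 1 "-1"]
    have "0 \<le> kernel_form (\<lambda>x. 1 * p x + -1 * Q n x) (\<lambda>x. 1 * p x + -1 * Q n x)"
      using assms(3) Q_int by (intro kernel_form_nonneg sq(1)) auto
    then have "0 \<le> kernel_form p p - 2 * kernel_form (Q n) p + kernel_form (Q n) (Q n)"
      unfolding sq(2) by (simp add: kernel_form_commute[of p "Q n"])
    moreover have "kernel_form (Q n) (Q n) \<le> kernel_form q q"
      unfolding kernel_form_def
      using QQ qq nn Q_nn Q_le
      by (intro integral_mono integrable_kernel_form mult_left_mono mult_mono)
        (auto simp: space_pair_measure space_omega intro!: real_of_ereal_pos)
    ultimately have "kernel_form (Q n) p \<le> C"
      by (simp add: C_def)
    then show ?thesis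
      using nn_integral_eq_kernel_form[OF Q assms(1) Q_nn nn(1,3) Qp]
      by (simp add: iter Q Q_nn ennreal_leI)
  qed
  note bound = this
  \<comment> \<open>\<open>H\<close> is finite at every point of \<open>X\<close>, so
    \<open>Q n v\<close> eventually equals \<open>q v\<close>, and monotone convergence carries the
    bound \<open>C\<close> over to \<open>q\<close>.\<close>
  have "(\<integral>\<^sup>+v. H v * ennreal (q v) \<partial>\<omega>) \<le> (\<integral>\<^sup>+v. (SUP n. H v * ennreal (Q n v)) \<partial>\<omega>)"
  proof (rule nn_integral_mono)
    fix v assume v: "v \<in> space \<omega>"
    obtain n :: nat where "H v < of_nat n"
      using ennreal_Ex_less_of_nat[of "H v"] potential[of v] v by (auto simp: H_def space_omega)
    then have "Q n v = q v"
      using v by (simp add: Q_def)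
    then show "H v * ennreal (q v) \<le> (SUP n. H v * ennreal (Q n v))"
      by (intro SUP_upper2[of n]) auto
  qed
  also have "\<dots> = (SUP n. \<integral>\<^sup>+v. H v * ennreal (Q n v) \<partial>\<omega>)"
  proof (rule nn_integral_monotone_convergence_SUP)
    show "incseq (\<lambda>n v. H v * ennreal (Q n v))"
    proof (intro incseq_SucI le_funI mult_left_mono ennreal_leI)
      fix n v
      have "H v \<le> of_nat n \<Longrightarrow> H v \<le> of_nat (Suc n)"
        by (erule order_trans) simp
      then show "Q n v \<le> Q (Suc n) v"
        using nn(2) by (auto simp: Q_def indicator_def simp del: of_nat_Suc)
    qed simp
  qed measurable
  also have "\<dots> \<le> ennreal C"
    by (intro SUP_least bound)
  also have "\<dots> < \<infinity>"
    by simp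
  finally show ?thesis
    unfolding kernel_integrable_def iter[OF assms(2) nn(2)] .
qed

text \<open>Bilinear expansion in coordinates. With \<open>F = a f\<close> and
  \<open>G = b f\<close> the matrix on the right is \<open>B\<close> of the designs with densities
  \<open>a\<close> and \<open>b\<close>, so \<open>x \<bullet> (B *v y)\<close> becomes a mixed
  energy of scalar densities.\<close>

lemma kernel_form_inner:
  fixes F G :: "'a \<Rightarrow> real ^ 'm"
  assumes [measurable]: "\<And>i. (\<lambda>u. F u $ i) \<in> borel_measurable \<omega>" "\<And>i. (\<lambda>u. G u $ i) \<in> borel_measurable \<omega>"
    and ki: "\<And>i j. kernel_integrable (\<lambda>u. F u $ i) (\<lambda>u. G u $ j)"
  shows "kernel_integrable (\<lambda>u. x \<bullet> F u) (\<lambda>u. y \<bullet> G u)"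
    and "kernel_form (\<lambda>u. x \<bullet> F u) (\<lambda>u. y \<bullet> G u)
      = x \<bullet> ((\<chi> i j. kernel_form (\<lambda>u. F u $ i) (\<lambda>u. G u $ j)) *v y)"
proof -
  have m [measurable]: "(\<lambda>u. x \<bullet> F u) \<in> borel_measurable \<omega>" "(\<lambda>u. y \<bullet> G u) \<in> borel_measurable \<omega>"
    by (simp_all add: inner_vec_def)
  have i1: "kernel_integrable (\<lambda>u. x \<bullet> F u) (\<lambda>u. G u $ j)" for j
    unfolding inner_vec_def inner_real_def
    by (intro kernel_integrable_sum kernel_integrable_cmult ki) auto
  then have i1': "kernel_integrable (\<lambda>u. G u $ j) (\<lambda>u. x \<bullet> F u)" for j
    by (simp add: kernel_integrable_commute)
  have "kernel_integrable (\<lambda>u. y \<bullet> G u) (\<lambda>u. x \<bullet> F u)"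
    unfolding inner_vec_def[of y] inner_real_def
    by (intro kernel_integrable_sum kernel_integrable_cmult i1') auto
  then show "kernel_integrable (\<lambda>u. x \<bullet> F u) (\<lambda>u. y \<bullet> G u)"
    by (simp add: kernel_integrable_commute)
  have f1: "kernel_form (\<lambda>u. x \<bullet> F u) (\<lambda>u. G u $ j)
      = (\<Sum>i\<in>UNIV. x $ i * kernel_form (\<lambda>u. F u $ i) (\<lambda>u. G u $ j))" for j
    unfolding inner_vec_def inner_real_def
    by (subst kernel_form_sum) (auto intro!: kernel_integrable_cmult ki simp: kernel_form_cmult)
  have "kernel_form (\<lambda>u. x \<bullet> F u) (\<lambda>u. y \<bullet> G u) = kernel_form (\<lambda>u. y \<bullet> G u) (\<lambda>u. x \<bullet> F u)"
    by (rule kernel_form_commute) measurable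
  also have "\<dots> = (\<Sum>j\<in>UNIV. y $ j * kernel_form (\<lambda>u. G u $ j) (\<lambda>u. x \<bullet> F u))"
    unfolding inner_vec_def[of y] inner_real_def
    by (subst kernel_form_sum) (auto intro!: kernel_integrable_cmult i1' simp: kernel_form_cmult)
  also have "\<dots> = (\<Sum>j\<in>UNIV. y $ j * kernel_form (\<lambda>u. x \<bullet> F u) (\<lambda>u. G u $ j))"
    by (simp add: kernel_form_commute[of "\<lambda>u. x \<bullet> F u"])
  also have "\<dots> = x \<bullet> ((\<chi> i j. kernel_form (\<lambda>u. F u $ i) (\<lambda>u. G u $ j)) *v y)"
    unfolding f1 sum_distrib_left
    by (subst sum.swap) (simp add: inner_vec_def matrix_vector_mult_def sum_distrib_left ac_simps)
  finally show "kernel_form (\<lambda>u. x \<bullet> F u) (\<lambda>u. y \<bullet> G u)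
      = x \<bullet> ((\<chi> i j. kernel_form (\<lambda>u. F u $ i) (\<lambda>u. G u $ j)) *v y)" .
qed

lemma B_exists_density_iff:
  fixes f :: "'a \<Rightarrow> real ^ 'm"
  assumes "a \<in> borel_measurable \<omega>" "b \<in> borel_measurable \<omega>" "\<And>i. (\<lambda>u. f u $ i) \<in> borel_measurable \<omega>"
    and "\<And>x. 0 \<le> a x" "\<And>x. 0 \<le> b x" and "finite_measure (density \<omega> b)"
  shows "B_exists K f (density \<omega> a) (density \<omega> b)
    \<longleftrightarrow> (\<forall>i j. kernel_integrable (\<lambda>u. (a u *\<^sub>R f u) $ i) (\<lambda>u. (b u *\<^sub>R f u) $ j))"
  using assms by (simp add: B_exists_def eintegrable_density_iff mult.commute)

lemma B_matrix_density:
  fixes f :: "'a \<Rightarrow> real ^ 'm"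
  assumes "a \<in> borel_measurable \<omega>" "b \<in> borel_measurable \<omega>" "\<And>i. (\<lambda>u. f u $ i) \<in> borel_measurable \<omega>"
    and "\<And>x. 0 \<le> a x" "\<And>x. 0 \<le> b x" and "finite_measure (density \<omega> b)"
  shows "B_matrix K f (density \<omega> a) (density \<omega> b)
    = (\<chi> i j. kernel_form (\<lambda>u. (a u *\<^sub>R f u) $ i) (\<lambda>u. (b u *\<^sub>R f u) $ j))"
  using assms by (simp add: B_matrix_def eintegral_density mult.commute)

end


subsection \<open>Dominating designs\<close>

text \<open>Both designs are absolutely continuous with respect to their average, and Radon-Nikodym
  derivatives of finite measures can be chosen real and nonnegative everywhere.\<close>

lemma common_dominating_design:
  assumes "design X \<xi>" "design X \<nu>"
  obtains \<omega> and a b :: "'a::topological_space \<Rightarrow> real" where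
    "design X \<omega>" "a \<in> borel_measurable \<omega>" "b \<in> borel_measurable \<omega>"
    "\<And>x. 0 \<le> a x" "\<And>x. 0 \<le> b x" "\<xi> = density \<omega> a" "\<nu> = density \<omega> b"
proof -
  let ?S = "restrict_space borel X"
  interpret \<xi>: prob_space \<xi> using assms(1) by (simp add: design_def)
  interpret \<nu>: prob_space \<nu> using assms(2) by (simp add: design_def)
  have sets: "sets \<xi> = sets ?S" "sets \<nu> = sets ?S"
    using assms by (auto simp: design_def)
  \<comment> \<open>Drawing from \<open>\<xi>\<close> or \<open>\<nu>\<close> by a fair coin gives
    the average of the two designs.\<close>
  define \<omega> where "\<omega> = measure_pmf (bernoulli_pmf (1/2)) \<bind> (\<lambda>c. if c then \<xi> else \<nu>)"
  have k: "(\<lambda>c. if c then \<xi> else \<nu>) \<in> measure_pmf (bernoulli_pmf (1/2)) \<rightarrow>\<^sub>M subprob_algebra ?S"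
    by (auto simp: measurable_def space_subprob_algebra sets split: if_splits
        intro: \<xi>.subprob_space_axioms \<nu>.subprob_space_axioms)
  have sw: "sets \<omega> = sets ?S"
    unfolding \<omega>_def by (rule sets_bind) (simp_all add: sets)
  have "prob_space \<omega>"
    unfolding \<omega>_def
    by (rule prob_space.prob_space_bind[OF _ _ k])
      (auto simp: measure_pmf.prob_space_axioms \<xi>.prob_space_axioms \<nu>.prob_space_axioms)
  then interpret \<omega>: prob_space \<omega> .
  have em: "emeasure \<omega> A = emeasure \<xi> A * ennreal (1/2) + emeasure \<nu> A * ennreal (1/2)"
    if "A \<in> sets ?S" for A
    unfolding \<omega>_def by (subst emeasure_bind[OF _ k that]) auto
  have density: "\<exists>d. d \<in> \<omega> \<rightarrow>\<^sub>M (borel :: real measure) \<and> (\<forall>x. 0 \<le> d x) \<and> \<mu> = density \<omega> d"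
    if "prob_space \<mu>" "sets \<mu> = sets ?S" "\<And>A. A \<in> sets ?S \<Longrightarrow> emeasure \<omega> A = 0 \<Longrightarrow> emeasure \<mu> A = 0"
    for \<mu>
  proof -
    interpret \<mu>: prob_space \<mu> by fact
    have ac: "absolutely_continuous \<omega> \<mu>" "sets \<mu> = sets \<omega>"
      using that by (auto simp: absolutely_continuous_def null_sets_def sw)
    obtain d where d: "d \<in> borel_measurable \<omega>" "AE x in \<omega>. RN_deriv \<omega> \<mu> x = ennreal (d x)"
        "\<And>x. 0 \<le> d x"
      using \<omega>.real_RN_deriv[OF \<mu>.finite_measure_axioms ac] by metis
    have "\<mu> = density \<omega> (RN_deriv \<omega> \<mu>)"
      using \<omega>.density_RN_deriv[OF ac] by simp
    also have "\<dots> = density \<omega> d"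
      using d by (intro density_cong) auto
    finally show ?thesis
      using d by auto
  qed
  have "design X \<omega>"
    using sw \<omega>.prob_space_axioms by (simp add: design_def)
  moreover obtain a :: "'a \<Rightarrow> real" where "a \<in> borel_measurable \<omega>" "\<And>x. 0 \<le> a x" "\<xi> = density \<omega> a"
    using density[of \<xi>] sets \<xi>.prob_space_axioms by (auto simp: em)
  moreover obtain b :: "'a \<Rightarrow> real" where "b \<in> borel_measurable \<omega>" "\<And>x. 0 \<le> b x" "\<nu> = density \<omega> b"
    using density[of \<nu>] sets \<nu>.prob_space_axioms by (auto simp: em)
  ultimately show ?thesis
    using that by blast
qed

text \<open>Only measurability needs an argument. For finite kernels it is part of the existence of
  the double integral of \<open>\<omega>\<close>; a singular kernel is continuous off the diagonal
  and infinite on it.\<close>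

lemma kernel_on_space_design:
  fixes X :: "'a::{real_normed_vector, second_countable_topology} set"
  assumes K: "covariance_kernel X K" and \<omega>: "design X \<omega>"
  shows "kernel_on_space X K \<omega>"
proof -
  interpret prob_space \<omega> using \<omega> by (simp add: design_def)
  have sw [measurable_cong]: "sets \<omega> = sets (restrict_space borel X)"
    using \<omega> by (simp add: design_def)
  have space: "space \<omega> = X"
    using sets_eq_imp_space_eq[OF sw] by (simp add: space_restrict_space)
  have pd: "positive_definite_kernel X K"
    using K by (simp add: covariance_kernel_def)
  have "(\<lambda>z. K (fst z) (snd z)) \<in> borel_measurable (\<omega> \<Otimes>\<^sub>M \<omega>)"
  proof (cases "finite_kernel X K")
    case True
    have "finite_borel_measure X \<omega>"
      using sw by (simp add: finite_borel_measure_def finite_measure_axioms)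
    then have "double_integral_exists K \<omega> \<omega>"
      using pd True by (auto simp: positive_definite_kernel_def)
    then show ?thesis
      by (auto simp: double_integral_exists_def eintegrable_def split_beta')
  next
    case False
    then have "singular_kernel X K"
      using K by (simp add: covariance_kernel_def)
    then obtain r :: "'a \<Rightarrow> ereal" where r: "\<forall>u\<in>X. \<forall>v\<in>X. K u v = r (u - v)" "r 0 = \<infinity>"
      unfolding singular_kernel_def by blast
    have [measurable]: "fst \<in> borel_measurable (\<omega> \<Otimes>\<^sub>M \<omega>)" "snd \<in> borel_measurable (\<omega> \<Otimes>\<^sub>M \<omega>)"
    proof -
      have id: "(\<lambda>x. x) \<in> borel_measurable \<omega>"
        using measurable_restrict_space1[of "\<lambda>x. x" borel borel X] measurable_cong_sets[OF sw refl]
        by auto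
      show "fst \<in> borel_measurable (\<omega> \<Otimes>\<^sub>M \<omega>)" "snd \<in> borel_measurable (\<omega> \<Otimes>\<^sub>M \<omega>)"
        by (rule measurable_compose[OF measurable_fst id], rule measurable_compose[OF measurable_snd id])
    qed
    let ?D = "X \<times> X - {z. fst z = snd z}"
    have "continuous_on ?D (\<lambda>z. K (fst z) (snd z))"
      unfolding continuous_on_eq_continuous_within
    proof
      fix z assume "z \<in> ?D"
      then have "continuous (at z within X \<times> X) (\<lambda>z. K (fst z) (snd z))"
        using K by (auto simp: covariance_kernel_def split_beta')
      then show "continuous (at z within ?D) (\<lambda>z. K (fst z) (snd z))"
        by (rule continuous_within_subset) auto
    qed
    then have cont: "(\<lambda>z. K (fst z) (snd z)) \<in> borel_measurable (restrict_space borel ?D)"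
      by (rule borel_measurable_continuous_on_restrict)
    let ?R = "restrict_space (\<omega> \<Otimes>\<^sub>M \<omega>) {z. \<not> fst z = snd z}"
    have "(\<lambda>z. (fst z, snd z)) \<in> ?R \<rightarrow>\<^sub>M restrict_space borel ?D"
      by (intro measurable_restrict_space2 measurable_restrict_space1 borel_measurable_Pair)
        (auto simp: space_restrict_space space_pair_measure space)
    from measurable_compose[OF this cont]
    have "(\<lambda>z. K (fst z) (snd z)) \<in> borel_measurable ?R"
      by simp
    \<comment> \<open>The diagonal is a measurable set, so the continuous part can be glued to the
      constant value on it.\<close>
    then have "(\<lambda>z. if fst z = snd z then \<infinity> else K (fst z) (snd z)) \<in> borel_measurable (\<omega> \<Otimes>\<^sub>M \<omega>)"
      by (subst measurable_If_restrict_space_iff) auto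
    then show ?thesis
      by (rule measurable_cong[THEN iffD1, rotated]) (use r in \<open>auto simp: space_pair_measure space\<close>)
  qed
  then show ?thesis
    using K by unfold_locales (auto simp: sw covariance_kernel_def)
qed

lemma eintegrable_imp_integrable:
  assumes "eintegrable N F"
  shows "integrable N (\<lambda>x. real_of_ereal (F x))"
proof (rule integrableI_bounded)
  show "(\<lambda>x. real_of_ereal (F x)) \<in> borel_measurable N"
    using assms by (auto simp: eintegrable_def)
  have "(\<integral>\<^sup>+x. norm (real_of_ereal (F x)) \<partial>N) \<le> (\<integral>\<^sup>+x. e2ennreal \<bar>F x\<bar> \<partial>N)"
    unfolding real_norm_def by (intro nn_integral_mono e2ennreal_abs_real)
  then show "(\<integral>\<^sup>+x. norm (real_of_ereal (F x)) \<partial>N) < \<infinity>"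
    using assms by (auto simp: eintegrable_def)
qed


subsection \<open>Matrices and moments\<close>

lemma matrix_inv_mult:
  fixes A :: "'a::semiring_1 ^ 'n ^ 'm"
  assumes "invertible A"
  shows "A ** matrix_inv A = mat 1" "matrix_inv A ** A = mat 1"
  using someI_ex[OF assms[unfolded invertible_def]] by (simp_all add: matrix_inv_def)

lemma matrix_inv_vector:
  fixes A :: "real ^ 'n ^ 'n"
  assumes "invertible A"
  shows "A *v (matrix_inv A *v x) = x" "matrix_inv A *v (A *v x) = x"
  using matrix_inv_mult[OF assms] by (simp_all add: matrix_vector_mul_assoc)

lemma transpose_matrix_inv:
  fixes A :: "real ^ 'n ^ 'n"
  assumes "invertible A" "transpose A = A"
  shows "transpose (matrix_inv A) = matrix_inv A"
proof -
  have "transpose (matrix_inv A) ** A = mat 1"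
    using matrix_inv_mult(1)[OF assms(1)] assms(2)
    by (metis matrix_transpose_mul transpose_mat)
  then have "transpose (matrix_inv A) ** (A ** matrix_inv A) = matrix_inv A"
    by (simp add: matrix_mul_assoc)
  then show ?thesis
    using matrix_inv_mult(1)[OF assms(1)] by simp
qed

lemma inner_symmetric_matrix:
  fixes A :: "real ^ 'n ^ 'n"
  assumes "transpose A = A"
  shows "x \<bullet> (A *v y) = (A *v x) \<bullet> y"
  using assms by (metis dot_lmul_matrix transpose_matrix_vector)

text \<open>If the component \<open>h\<close> of \<open>g\<close> orthogonal to \<open>f\<close>
  were nonzero, the vector \<open>c *\<^sub>R h - f\<close> with large \<open>c\<close> would have a
  positive product with \<open>g\<close> and a negative one with \<open>f\<close>.\<close>

lemma collinear_if_inner_products_same_sign: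
  fixes g f :: "'a::real_inner"
  assumes "f \<noteq> 0" and same_sign: "\<And>z. 0 \<le> (z \<bullet> g) * (z \<bullet> f)"
  shows "0 \<le> g \<bullet> f / (f \<bullet> f)" and "g = (g \<bullet> f / (f \<bullet> f)) *\<^sub>R f"
proof -
  have ff: "0 < f \<bullet> f"
    using assms(1) by simp
  have "0 \<le> (g \<bullet> f) * (f \<bullet> f)"
    using same_sign[of f] by (simp add: inner_commute)
  then have gf: "0 \<le> g \<bullet> f"
    using ff by (simp add: zero_le_mult_iff)
  then show "0 \<le> g \<bullet> f / (f \<bullet> f)"
    by simp
  define h where "h = g - (g \<bullet> f / (f \<bullet> f)) *\<^sub>R f"
  have hf: "h \<bullet> f = 0"
    using ff by (simp add: h_def inner_diff_left)
  have hg: "h \<bullet> g = h \<bullet> h"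
    using hf by (simp add: h_def inner_diff_right)
  \<comment> \<open>For \<open>h \<noteq> 0\<close> this makes \<open>c * (h \<bullet> h)\<close>
    exceed \<open>g \<bullet> f\<close> by exactly 1.\<close>
  define c where "c = (g \<bullet> f + 1) / (h \<bullet> h)"
  have "0 \<le> ((c *\<^sub>R h - f) \<bullet> g) * ((c *\<^sub>R h - f) \<bullet> f)"
    by (rule same_sign)
  also have "\<dots> = (c * (h \<bullet> h) - g \<bullet> f) * (- (f \<bullet> f))"
    by (simp add: inner_diff_left hf hg inner_commute[of f g])
  finally have "(c * (h \<bullet> h) - g \<bullet> f) * (f \<bullet> f) \<le> 0"
    by simp
  then have "c * (h \<bullet> h) \<le> g \<bullet> f"
    by (meson ff mult_pos_pos not_le diff_gt_0_iff_gt)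
  then have "h \<bullet> h = 0"
    by (cases "h \<bullet> h = 0") (simp_all add: c_def)
  then show "g = (g \<bullet> f / (f \<bullet> f)) *\<^sub>R f"
    by (simp add: h_def)
qed

text \<open>An elementary form of letting \<open>t\<close> tend to 0, used to extract the
  first-order condition.\<close>

lemma nonpos_if_small_multiples:
  fixes A C :: real
  assumes "\<And>t. 0 < t \<Longrightarrow> t < 1 \<Longrightarrow> (1 - t) * A \<le> t * C"
  shows "A \<le> 0"
proof (rule ccontr)
  assume "\<not> A \<le> 0"
  then have A: "0 < A" by simp
  \<comment> \<open>Chosen so that \<open>t * (A + \<bar>C\<bar>)\<close> is \<open>A / 2\<close>,
    which is less than \<open>A\<close>.\<close>
  define t where "t = A / (2 * (A + \<bar>C\<bar>))"
  have t: "0 < t" "t < 1"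
    using A by (auto simp: t_def field_simps)
  have "(1 - t) * A \<le> t * C"
    using t by (rule assms)
  also have "\<dots> \<le> t * \<bar>C\<bar>"
    using t by (intro mult_left_mono) auto
  finally have "A \<le> t * (A + \<bar>C\<bar>)"
    by (simp add: algebra_simps)
  also have "\<dots> = A / 2"
    using A by (simp add: t_def divide_simps)
  finally show False
    using A by simp
qed

section \<open>Matrices of a design and moments of continuous functions\<close>

lemma M_matrix_symmetric: "transpose (M_matrix f \<xi>) = M_matrix f \<xi>"
  by (simp add: transpose_def M_matrix_def mult.commute)

lemma inner_D_matrix:
  fixes f :: "'a \<Rightarrow> real ^ 'm"
  assumes "invertible (M_matrix f \<xi>)"
  shows "z \<bullet> (D_matrix K f \<xi> *v z)
    = (matrix_inv (M_matrix f \<xi>) *v z) \<bullet> (B_matrix K f \<xi> \<xi> *v (matrix_inv (M_matrix f \<xi>) *v z))"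
  unfolding D_matrix_def
  by (simp add: matrix_vector_mul_assoc[symmetric]
      inner_symmetric_matrix[OF transpose_matrix_inv[OF assms M_matrix_symmetric]])

lemma Lambda_M_matrix:
  assumes "invertible (M_matrix f \<xi>)"
  shows "Lambda_matrix K f \<xi> ** M_matrix f \<xi> = B_matrix K f \<xi> \<xi>"
  using matrix_inv_mult(2)[OF assms]
  by (simp add: Lambda_matrix_def matrix_mul_assoc[symmetric])

lemma design_integrable_continuous:
  fixes h :: "'a::{real_normed_vector, second_countable_topology} \<Rightarrow> real"
  assumes "design X \<mu>" "compact X" "continuous_on X h"
  shows "integrable \<mu> h"
proof -
  interpret prob_space \<mu> using assms(1) by (simp add: design_def)
  have sets: "sets \<mu> = sets (restrict_space borel X)"
    using assms(1) by (simp add: design_def)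
  have space: "space \<mu> = X"
    using sets_eq_imp_space_eq[OF sets] by (simp add: space_restrict_space)
  obtain C where "\<forall>x\<in>X. norm (h x) \<le> C"
    using compact_imp_bounded[OF compact_continuous_image[OF assms(3,2)]] by (auto simp: bounded_iff)
  then show ?thesis
    using borel_measurable_continuous_on_restrict[OF assms(3)]
    by (intro integrable_const_bound[of _ C] AE_I2)
      (auto simp: space measurable_cong_sets[OF sets refl])
qed

text \<open>Two functions are allowed because the lemma serves \<open>M\<close>, where both are
  \<open>f\<close>, and also \<open>B\<close>, where \<open>F\<close> is the vector potential of a
  design.\<close>

lemma inner_moment_matrix:
  fixes F G :: "'a::{real_normed_vector, second_countable_topology} \<Rightarrow> real ^ 'm"
  assumes "design X \<mu>" "compact X" "continuous_on X F" "continuous_on X G"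
  shows "(LINT u|\<mu>. (x \<bullet> F u) * (y \<bullet> G u))
    = x \<bullet> ((\<chi> i j. LINT u|\<mu>. F u $ i * G u $ j) *v y)"
proof -
  have int: "integrable \<mu> (\<lambda>u. F u $ i * G u $ j)" for i j
    using assms by (intro design_integrable_continuous continuous_intros)
  have "(LINT u|\<mu>. (x \<bullet> F u) * (y \<bullet> G u))
      = (LINT u|\<mu>. (\<Sum>i\<in>UNIV. \<Sum>j\<in>UNIV. (x $ i * y $ j) * (F u $ i * G u $ j)))"
    by (simp add: inner_vec_def sum_product ac_simps)
  also have "\<dots> = (\<Sum>i\<in>UNIV. \<Sum>j\<in>UNIV. (x $ i * y $ j) * (LINT u|\<mu>. F u $ i * G u $ j))"
    using int by (simp add: Bochner_Integration.integral_sum)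
  also have "\<dots> = x \<bullet> ((\<chi> i j. LINT u|\<mu>. F u $ i * G u $ j) *v y)"
    by (simp add: inner_vec_def matrix_vector_mult_def sum_distrib_left ac_simps)
  finally show ?thesis .
qed


subsection \<open>The regression model\<close>

locale regression_model =
  fixes X :: "'a::{real_normed_vector, second_countable_topology} set"
    and f :: "'a \<Rightarrow> real ^ 'm" and K :: "'a \<Rightarrow> 'a \<Rightarrow> ereal"
  assumes compact_X: "compact X"
    and continuous_f: "continuous_on X f"
    and covariance: "covariance_kernel X K"
begin

text \<open>The components of \<open>a f\<close> are integrable because \<open>f\<close> is bounded
  on the compact set \<open>X\<close> and \<open>a\<close> is a probability density; likewise for
  \<open>b f\<close>.\<close>

lemma dominating_design:
  assumes "design X \<xi>" "design X \<nu>"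
  obtains \<omega> and a b :: "'a \<Rightarrow> real" where
    "design X \<omega>" "kernel_on_space X K \<omega>" "a \<in> borel_measurable \<omega>" "b \<in> borel_measurable \<omega>"
    "\<And>x. 0 \<le> a x" "\<And>x. 0 \<le> b x" "\<xi> = density \<omega> a" "\<nu> = density \<omega> b"
    "finite_measure (density \<omega> a)" "finite_measure (density \<omega> b)"
    "\<And>i. (\<lambda>u. f u $ i) \<in> borel_measurable \<omega>"
    "\<And>i. (\<lambda>u. (a u *\<^sub>R f u) $ i) \<in> borel_measurable \<omega>"
    "\<And>i. (\<lambda>u. (b u *\<^sub>R f u) $ i) \<in> borel_measurable \<omega>"
    "\<And>i. integrable \<omega> (\<lambda>u. (a u *\<^sub>R f u) $ i)" "\<And>i. integrable \<omega> (\<lambda>u. (b u *\<^sub>R f u) $ i)"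
proof -
  obtain \<omega> and a b :: "'a \<Rightarrow> real" where \<omega>: "design X \<omega>"
    and ab [measurable]: "a \<in> borel_measurable \<omega>" "b \<in> borel_measurable \<omega>"
    and nn: "\<And>x. 0 \<le> a x" "\<And>x. 0 \<le> b x" and dens: "\<xi> = density \<omega> a" "\<nu> = density \<omega> b"
    using common_dominating_design[OF assms] by metis
  have f [measurable]: "(\<lambda>u. f u $ i) \<in> borel_measurable \<omega>" for i
    using continuous_f
    by (intro borel_measurable_integrable design_integrable_continuous[OF \<omega> compact_X] continuous_intros)
  have int: "integrable \<omega> (\<lambda>u. (c u *\<^sub>R f u) $ i)"
    if "c \<in> borel_measurable \<omega>" "\<And>x. 0 \<le> c x" "design X (density \<omega> c)" for c :: "'a \<Rightarrow> real" and i
  proof -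
    have "integrable (density \<omega> c) (\<lambda>u. f u $ i)"
      using continuous_f that by (intro design_integrable_continuous[OF _ compact_X] continuous_intros)
    then show ?thesis
      using that by (simp add: integrable_density)
  qed
  show ?thesis
    by (rule that[OF \<omega> kernel_on_space_design[OF covariance \<omega>] ab nn dens])
      (use assms int nn ab in \<open>auto simp: dens design_def prob_space.finite_measure\<close>)
qed

section \<open>Symmetry and positivity of \<open>B\<close>, mixtures, and potentials\<close>

lemma B_matrix_symmetric:
  assumes "design X \<xi>"
  shows "transpose (B_matrix K f \<xi> \<xi>) = B_matrix K f \<xi> \<xi>"
proof -
  obtain \<omega> and a :: "'a \<Rightarrow> real" where \<omega>: "kernel_on_space X K \<omega>"
    and a: "a \<in> borel_measurable \<omega>" "\<And>x. 0 \<le> a x" and \<xi>: "\<xi> = density \<omega> a"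
    "finite_measure (density \<omega> a)" and f: "\<And>i. (\<lambda>u. f u $ i) \<in> borel_measurable \<omega>"
    "\<And>i. (\<lambda>u. (a u *\<^sub>R f u) $ i) \<in> borel_measurable \<omega>"
    by (rule dominating_design[OF assms assms]) (rule that)
  interpret kernel_on_space X K \<omega> by fact
  show ?thesis
    using a \<xi> f by (simp add: transpose_def B_matrix_density kernel_form_commute vec_eq_iff del: vector_scaleR_component)
qed

text \<open>The sum is the energy of the signed measure with density \<open>x \<bullet> f\<close>
  against \<open>\<xi>\<close> plus density \<open>y \<bullet> f\<close> against
  \<open>\<nu>\<close>.\<close>

lemma B_matrix_nonneg:
  assumes "design X \<xi>" "design X \<nu>" "B_exists K f \<xi> \<xi>" "B_exists K f \<xi> \<nu>" "B_exists K f \<nu> \<nu>"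
  shows "0 \<le> x \<bullet> (B_matrix K f \<xi> \<xi> *v x) + 2 * (x \<bullet> (B_matrix K f \<xi> \<nu> *v y))
    + y \<bullet> (B_matrix K f \<nu> \<nu> *v y)"
proof -
  obtain \<omega> and a b :: "'a \<Rightarrow> real" where \<omega>: "kernel_on_space X K \<omega>"
    and ab: "a \<in> borel_measurable \<omega>" "b \<in> borel_measurable \<omega>" "\<And>x. 0 \<le> a x" "\<And>x. 0 \<le> b x"
    and dens: "\<xi> = density \<omega> a" "\<nu> = density \<omega> b"
    and fin: "finite_measure (density \<omega> a)" "finite_measure (density \<omega> b)"
    and f: "\<And>i. (\<lambda>u. f u $ i) \<in> borel_measurable \<omega>"
    and af: "\<And>i. (\<lambda>u. (a u *\<^sub>R f u) $ i) \<in> borel_measurable \<omega>"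
    and bf: "\<And>i. (\<lambda>u. (b u *\<^sub>R f u) $ i) \<in> borel_measurable \<omega>"
    and int: "\<And>i. integrable \<omega> (\<lambda>u. (a u *\<^sub>R f u) $ i)" "\<And>i. integrable \<omega> (\<lambda>u. (b u *\<^sub>R f u) $ i)"
    by (rule dominating_design[OF assms(1,2)]) (rule that)
  interpret kernel_on_space X K \<omega> by fact
  let ?p = "\<lambda>u. x \<bullet> (a u *\<^sub>R f u)" and ?q = "\<lambda>u. y \<bullet> (b u *\<^sub>R f u)"
  note ex = B_exists_density_iff[OF ab(1,1) f ab(3,3) fin(1), THEN iffD1, rule_format]
    B_exists_density_iff[OF ab(1,2) f ab(3,4) fin(2), THEN iffD1, rule_format]
    B_exists_density_iff[OF ab(2,2) f ab(4,4) fin(2), THEN iffD1, rule_format]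
  note xx = kernel_form_inner[OF af af ex(1)[OF assms(3)[unfolded dens]]]
  note xy = kernel_form_inner[OF af bf ex(2)[OF assms(4)[unfolded dens]]]
  note yy = kernel_form_inner[OF bf bf ex(3)[OF assms(5)[unfolded dens]]]
  have p: "?p \<in> borel_measurable \<omega>" "integrable \<omega> ?p" and q: "?q \<in> borel_measurable \<omega>" "integrable \<omega> ?q"
    using af bf int unfolding inner_vec_def inner_real_def by auto
  note sq = kernel_form_square[OF p(1) q(1) xx(1) xy(1) yy(1), of 1 1]
  have "0 \<le> kernel_form (\<lambda>u. 1 * ?p u + 1 * ?q u) (\<lambda>u. 1 * ?p u + 1 * ?q u)"
    using p q by (intro kernel_form_nonneg sq(1)) auto
  then show ?thesis
    unfolding sq(2) xx(2) xy(2) yy(2) dens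
    by (simp add: B_matrix_density ab f fin del: vector_scaleR_component)
qed

text \<open>The mixture has density \<open>(1 - t) * a + t * b\<close>. Since \<open>M\<close> is
  linear in the density and \<open>B\<close> quadratic, both become polynomials in \<open>t\<close>;
  the cross term is where mixed existence enters.\<close>

lemma mixture_design:
  assumes "design X \<xi>" "design X \<nu>" "B_exists K f \<xi> \<xi>" "B_exists K f \<xi> \<nu>" "B_exists K f \<nu> \<nu>"
    and t: "0 \<le> t" "t \<le> 1"
  obtains \<eta> where "design X \<eta>" "B_exists K f \<eta> \<eta>"
    "\<And>x. M_matrix f \<eta> *v x = (1 - t) *\<^sub>R (M_matrix f \<xi> *v x) + t *\<^sub>R (M_matrix f \<nu> *v x)"
    "\<And>x. x \<bullet> (B_matrix K f \<eta> \<eta> *v x) = (1 - t)\<^sup>2 * (x \<bullet> (B_matrix K f \<xi> \<xi> *v x))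
       + 2 * (1 - t) * t * (x \<bullet> (B_matrix K f \<xi> \<nu> *v x)) + t\<^sup>2 * (x \<bullet> (B_matrix K f \<nu> \<nu> *v x))"
proof -
  obtain \<omega> and a b :: "'a \<Rightarrow> real" where \<omega>: "kernel_on_space X K \<omega>" "design X \<omega>"
    and ab: "a \<in> borel_measurable \<omega>" "b \<in> borel_measurable \<omega>" "\<And>x. 0 \<le> a x" "\<And>x. 0 \<le> b x"
    and dens: "\<xi> = density \<omega> a" "\<nu> = density \<omega> b"
    and fin: "finite_measure (density \<omega> a)" "finite_measure (density \<omega> b)"
    and f: "\<And>i. (\<lambda>u. f u $ i) \<in> borel_measurable \<omega>"
    and af: "\<And>i. (\<lambda>u. (a u *\<^sub>R f u) $ i) \<in> borel_measurable \<omega>"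
    and bf: "\<And>i. (\<lambda>u. (b u *\<^sub>R f u) $ i) \<in> borel_measurable \<omega>"
    by (rule dominating_design[OF assms(1,2)]) (rule that)
  interpret kernel_on_space X K \<omega> by fact
  note [measurable] = ab(1,2) f af bf
  define c where "c u = (1 - t) * a u + t * b u" for u
  define \<eta> where "\<eta> = density \<omega> c"
  have c [measurable]: "c \<in> borel_measurable \<omega>" and c_nn: "\<And>x. 0 \<le> c x"
    using ab t by (auto simp: c_def [abs_def])
  have nn_c: "(\<integral>\<^sup>+x. ennreal (c x) * h x \<partial>\<omega>)
      = ennreal (1 - t) * (\<integral>\<^sup>+x. h x \<partial>\<xi>) + ennreal t * (\<integral>\<^sup>+x. h x \<partial>\<nu>)"
    if [measurable]: "h \<in> borel_measurable \<omega>" for h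
  proof -
    have "ennreal (c x) = ennreal (1 - t) * ennreal (a x) + ennreal t * ennreal (b x)" for x
      using ab t by (simp add: c_def ennreal_mult)
    then have "(\<integral>\<^sup>+x. ennreal (c x) * h x \<partial>\<omega>)
        = (\<integral>\<^sup>+x. ennreal (1 - t) * (ennreal (a x) * h x) + ennreal t * (ennreal (b x) * h x) \<partial>\<omega>)"
      by (simp add: distrib_right mult.assoc)
    then show ?thesis
      by (simp add: dens nn_integral_add nn_integral_cmult nn_integral_density)
  qed
  have prob: "prob_space \<xi>" "prob_space \<nu>"
    using assms by (auto simp: design_def)
  have "emeasure \<xi> (space \<omega>) = 1" "emeasure \<nu> (space \<omega>) = 1"
    using prob_space.emeasure_space_1[OF prob(1)] prob_space.emeasure_space_1[OF prob(2)]
    by (simp_all add: dens)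
  then have "emeasure \<eta> (space \<omega>) = ennreal (1 - t) + ennreal t"
    using nn_c[of "indicator (space \<omega>)"] by (simp add: \<eta>_def emeasure_density dens)
  also have "\<dots> = 1"
    using t by (simp add: ennreal_plus[symmetric] del: ennreal_plus)
  finally have design: "design X \<eta>"
    unfolding design_def by (intro conjI prob_spaceI) (auto simp: \<eta>_def sets_omega)
  then have fin_c: "finite_measure (density \<omega> c)"
    by (simp add: \<eta>_def design_def prob_space.finite_measure)
  have cf: "(c u *\<^sub>R f u) $ i = (1 - t) * (a u *\<^sub>R f u) $ i + t * (b u *\<^sub>R f u) $ i" for u i
    by (simp add: c_def algebra_simps)
  have cf_m [measurable]: "(\<lambda>u. (c u *\<^sub>R f u) $ i) \<in> borel_measurable \<omega>" for i
    unfolding cf by measurable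
  note ex = B_exists_density_iff[OF ab(1,1) f ab(3,3) fin(1), THEN iffD1, rule_format]
    B_exists_density_iff[OF ab(1,2) f ab(3,4) fin(2), THEN iffD1, rule_format]
    B_exists_density_iff[OF ab(2,2) f ab(4,4) fin(2), THEN iffD1, rule_format]
  note ki = ex(1)[OF assms(3)[unfolded dens]] ex(2)[OF assms(4)[unfolded dens]]
    ex(3)[OF assms(5)[unfolded dens]]
  have ki_c: "kernel_integrable (\<lambda>u. (c u *\<^sub>R f u) $ i) (\<lambda>u. (c u *\<^sub>R f u) $ j)" for i j
  proof -
    have step: "kernel_integrable (\<lambda>u. (c u *\<^sub>R f u) $ i) r"
      if [measurable]: "r \<in> borel_measurable \<omega>" and "kernel_integrable (\<lambda>u. (a u *\<^sub>R f u) $ i) r"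
        "kernel_integrable (\<lambda>u. (b u *\<^sub>R f u) $ i) r" for r i
      unfolding cf using that by (intro kernel_integrable_add kernel_integrable_cmult) measurable
    have ba: "kernel_integrable (\<lambda>u. (b u *\<^sub>R f u) $ i) (\<lambda>u. (a u *\<^sub>R f u) $ j)" for i j
      using ki(2)[of j i] by (rule kernel_integrable_commute[THEN iffD1, rotated 2]) measurable
    have "kernel_integrable (\<lambda>u. (c u *\<^sub>R f u) $ i) (\<lambda>u. (a u *\<^sub>R f u) $ j)"
        "kernel_integrable (\<lambda>u. (c u *\<^sub>R f u) $ i) (\<lambda>u. (b u *\<^sub>R f u) $ j)" for i j
      by (rule step[OF af ki(1) ba], rule step[OF bf ki(2,3)])
    then have "kernel_integrable (\<lambda>u. (a u *\<^sub>R f u) $ i) (\<lambda>u. (c u *\<^sub>R f u) $ j)"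
        "kernel_integrable (\<lambda>u. (b u *\<^sub>R f u) $ i) (\<lambda>u. (c u *\<^sub>R f u) $ j)" for i j
      using kernel_integrable_commute cf_m af bf by blast+
    then show ?thesis
      by (intro step cf_m)
  qed
  show ?thesis
  proof (rule that[OF design])
    show "B_exists K f \<eta> \<eta>"
      unfolding \<eta>_def using ki_c c c_nn f fin_c by (subst B_exists_density_iff) auto
  next
    fix x
    have "integrable \<mu> (\<lambda>u. f u $ i * f u $ j)" if "design X \<mu>" for \<mu> i j
      using that continuous_f by (intro design_integrable_continuous[OF _ compact_X] continuous_intros)
    then have "M_matrix f \<eta> $ i $ j = (1 - t) * M_matrix f \<xi> $ i $ j + t * M_matrix f \<nu> $ i $ j" for i j
    proof -
      assume int: "\<And>\<mu> i j. design X \<mu> \<Longrightarrow> integrable \<mu> (\<lambda>u. f u $ i * f u $ j)"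
      have "integrable \<omega> (\<lambda>u. a u * (f u $ i * f u $ j))" "integrable \<omega> (\<lambda>u. b u * (f u $ i * f u $ j))"
        using int[OF assms(1), of i j] int[OF assms(2), of i j] ab
        by (simp_all add: dens integrable_density)
      then have "(LINT u|\<omega>. c u * (f u $ i * f u $ j))
          = (1 - t) * (LINT u|\<omega>. a u * (f u $ i * f u $ j)) + t * (LINT u|\<omega>. b u * (f u $ i * f u $ j))"
        by (simp add: c_def distrib_right mult.assoc)
      then show ?thesis
        using ab c_nn by (simp add: M_matrix_def \<eta>_def dens integral_density)
    qed
    then have "M_matrix f \<eta> = (1 - t) *\<^sub>R M_matrix f \<xi> + t *\<^sub>R M_matrix f \<nu>"
      by (simp add: vec_eq_iff)
    then show "M_matrix f \<eta> *v x = (1 - t) *\<^sub>R (M_matrix f \<xi> *v x) + t *\<^sub>R (M_matrix f \<nu> *v x)"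
      by (simp add: matrix_vector_mult_add_rdistrib scaleR_matrix_vector_assoc)
  next
    fix x
    let ?p = "\<lambda>u. x \<bullet> (a u *\<^sub>R f u)" and ?q = "\<lambda>u. x \<bullet> (b u *\<^sub>R f u)"
    note xx = kernel_form_inner[OF af af ki(1)] and xy = kernel_form_inner[OF af bf ki(2)]
      and yy = kernel_form_inner[OF bf bf ki(3)]
    have p: "?p \<in> borel_measurable \<omega>" and q: "?q \<in> borel_measurable \<omega>"
      using af bf unfolding inner_vec_def inner_real_def by auto
    note sq = kernel_form_square(2)[OF p q xx(1) xy(1) yy(1), of "1 - t" t]
    have "x \<bullet> (B_matrix K f \<eta> \<eta> *v x) = kernel_form (\<lambda>u. x \<bullet> (c u *\<^sub>R f u)) (\<lambda>u. x \<bullet> (c u *\<^sub>R f u))"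
      unfolding \<eta>_def kernel_form_inner(2)[OF cf_m cf_m ki_c]
      by (simp add: B_matrix_density c c_nn f fin_c del: vector_scaleR_component)
    also have "(\<lambda>u. x \<bullet> (c u *\<^sub>R f u)) = (\<lambda>u. (1 - t) * ?p u + t * ?q u)"
      by (auto simp: c_def algebra_simps)
    also note sq
    also note xx(2)
    also note xy(2)
    also note yy(2)
    finally show "x \<bullet> (B_matrix K f \<eta> \<eta> *v x) = (1 - t)\<^sup>2 * (x \<bullet> (B_matrix K f \<xi> \<xi> *v x))
       + 2 * (1 - t) * t * (x \<bullet> (B_matrix K f \<xi> \<nu> *v x)) + t\<^sup>2 * (x \<bullet> (B_matrix K f \<nu> \<nu> *v x))"
      unfolding dens by (simp add: B_matrix_density ab f fin del: vector_scaleR_component)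
  qed
qed

text \<open>Finite kernels integrate all signed measures. A singular kernel is nonnegative, and
  \<open>g_exists\<close> makes the potentials of the components of \<open>f\<close> under
  \<open>\<xi>\<close> finite at every point, so the truncation argument of
  \<open>kernel_integrable_mixed\<close> applies to absolute values.\<close>

lemma B_exists_mixed:
  assumes "design X \<xi>" "design X \<nu>" "B_exists K f \<xi> \<xi>" "B_exists K f \<nu> \<nu>" "g_exists X K f \<xi>"
  shows "B_exists K f \<xi> \<nu>"
proof -
  obtain \<omega> and a b :: "'a \<Rightarrow> real" where \<omega>: "kernel_on_space X K \<omega>"
    and ab: "a \<in> borel_measurable \<omega>" "b \<in> borel_measurable \<omega>" "\<And>x. 0 \<le> a x" "\<And>x. 0 \<le> b x"
    and dens: "\<xi> = density \<omega> a" "\<nu> = density \<omega> b"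
    and fin: "finite_measure (density \<omega> a)" "finite_measure (density \<omega> b)"
    and f: "\<And>i. (\<lambda>u. f u $ i) \<in> borel_measurable \<omega>"
    and af: "\<And>i. (\<lambda>u. (a u *\<^sub>R f u) $ i) \<in> borel_measurable \<omega>"
    and bf: "\<And>i. (\<lambda>u. (b u *\<^sub>R f u) $ i) \<in> borel_measurable \<omega>"
    and int: "\<And>i. integrable \<omega> (\<lambda>u. (a u *\<^sub>R f u) $ i)" "\<And>i. integrable \<omega> (\<lambda>u. (b u *\<^sub>R f u) $ i)"
    by (rule dominating_design[OF assms(1,2)]) (rule that)
  interpret kernel_on_space X K \<omega> by fact
  note ex = B_exists_density_iff[OF ab(1,1) f ab(3,3) fin(1), THEN iffD1, rule_format]
    B_exists_density_iff[OF ab(2,2) f ab(4,4) fin(2), THEN iffD1, rule_format]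
  note ki = ex(1)[OF assms(3)[unfolded dens]] ex(2)[OF assms(4)[unfolded dens]]
  have "kernel_integrable (\<lambda>u. (a u *\<^sub>R f u) $ i) (\<lambda>u. (b u *\<^sub>R f u) $ j)" for i j
  proof (cases "finite_kernel X K")
    case True
    then show ?thesis
      using af bf int by (intro kernel_integrable_finite_kernel)
  next
    case False
    then have "singular_kernel X K"
      using covariance by (simp add: covariance_kernel_def)
    then obtain r :: "'a \<Rightarrow> ereal" where r: "\<forall>u\<in>X. \<forall>v\<in>X. K u v = r (u - v)"
        "\<forall>t. t \<noteq> 0 \<longrightarrow> 0 \<le> r t \<and> r t < \<infinity>" "r 0 = \<infinity>"
      unfolding singular_kernel_def by blast
    have r_nn: "0 \<le> r t" for t
      using r(2,3) by (cases "t = 0") auto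
    have K_nn: "0 \<le> K u v" if "u \<in> X" "v \<in> X" for u v
      using r(1) r_nn that by simp
    let ?p = "\<lambda>u. \<bar>(a u *\<^sub>R f u) $ i\<bar>" and ?q = "\<lambda>u. \<bar>(b u *\<^sub>R f u) $ j\<bar>"
    have "kernel_integrable ?q ?p"
    proof (rule kernel_integrable_mixed)
      show "kernel_integrable ?p ?p" "kernel_integrable ?q ?q"
        using ki(1)[of i i] ki(2)[of j j] by (auto elim: kernel_integrable_mono)
    next
      fix v assume "v \<in> X"
      then have e: "eintegrable (density \<omega> a) (\<lambda>u. K v u * ereal (f u $ i))"
        using assms(5) by (simp add: g_exists_def dens)
      then have [measurable]: "(\<lambda>u. K v u * ereal (f u $ i)) \<in> borel_measurable \<omega>"
        by (simp add: eintegrable_def)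
      have "(\<integral>\<^sup>+u. e2ennreal \<bar>K v u\<bar> * ennreal (?p u) \<partial>\<omega>)
          = (\<integral>\<^sup>+u. ennreal (a u) * e2ennreal \<bar>K v u * ereal (f u $ i)\<bar> \<partial>\<omega>)"
        using ab by (simp add: e2ennreal_abs_mult abs_mult ennreal_mult ac_simps)
      also have "\<dots> = (\<integral>\<^sup>+u. e2ennreal \<bar>K v u * ereal (f u $ i)\<bar> \<partial>density \<omega> a)"
        using ab by (subst nn_integral_density) auto
      also have "\<dots> < \<infinity>"
        using e by (simp add: eintegrable_def)
      finally show "(\<integral>\<^sup>+u. e2ennreal \<bar>K v u\<bar> * ennreal (?p u) \<partial>\<omega>) < \<infinity>" .
    qed (use af bf int K_nn in auto)
    then have "kernel_integrable (\<lambda>u. (b u *\<^sub>R f u) $ j) (\<lambda>u. (a u *\<^sub>R f u) $ i)"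
      by (rule kernel_integrable_mono) auto
    then show ?thesis
      using kernel_integrable_commute af bf by blast
  qed
  then show ?thesis
    unfolding dens using ab f fin by (subst B_exists_density_iff) auto
qed

text \<open>Fubini, with symmetry of \<open>K\<close> turning the inner integral into the potential
  of \<open>\<xi>\<close> at \<open>x\<close>.\<close>

lemma B_matrix_potential:
  assumes "design X \<xi>" "design X \<nu>" "B_exists K f \<xi> \<nu>"
  shows "B_matrix K f \<xi> \<nu> $ i $ j
    = (LINT x|\<nu>. eintegral \<xi> (\<lambda>u. K x u * ereal (f u $ i)) * f x $ j)"
proof -
  interpret \<xi>: prob_space \<xi> using assms by (simp add: design_def)
  interpret \<nu>: prob_space \<nu> using assms by (simp add: design_def)
  interpret pair_sigma_finite \<xi> \<nu> ..
  have space: "space \<mu> = X" if "design X \<mu>" for \<mu>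
    using that sets_eq_imp_space_eq[of \<mu> "restrict_space borel X"]
    by (simp add: design_def space_restrict_space)
  have sym: "K u v = K v u" if "u \<in> X" "v \<in> X" for u v
    using covariance that by (simp add: covariance_kernel_def)
  let ?h = "\<lambda>u x. real_of_ereal (K u x) * (f u $ i * f x $ j)"
  have "integrable (\<xi> \<Otimes>\<^sub>M \<nu>) (\<lambda>z. real_of_ereal (case z of (u, v) \<Rightarrow> K u v * ereal (f u $ i * f v $ j)))"
    using assms(3) by (intro eintegrable_imp_integrable) (simp add: B_exists_def)
  then have "integrable (\<xi> \<Otimes>\<^sub>M \<nu>) (case_prod ?h)"
    by (simp add: split_beta')
  then have "(LINT x|\<nu>. LINT u|\<xi>. ?h u x) = (LINT z|(\<xi> \<Otimes>\<^sub>M \<nu>). case_prod ?h z)"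
    by (rule integral_snd)
  also have "\<dots> = B_matrix K f \<xi> \<nu> $ i $ j"
    by (simp add: B_matrix_def eintegral_def split_beta')
  also have "(LINT x|\<nu>. LINT u|\<xi>. ?h u x)
      = (LINT x|\<nu>. eintegral \<xi> (\<lambda>u. K x u * ereal (f u $ i)) * f x $ j)"
  proof (rule Bochner_Integration.integral_cong[OF refl])
    fix x assume x: "x \<in> space \<nu>"
    have "(LINT u|\<xi>. ?h u x) = (LINT u|\<xi>. (real_of_ereal (K x u) * f u $ i) * f x $ j)"
      using x by (intro Bochner_Integration.integral_cong[OF refl])
        (simp add: space assms sym mult.assoc)
    then show "(LINT u|\<xi>. ?h u x) = eintegral \<xi> (\<lambda>u. K x u * ereal (f u $ i)) * f x $ j"
      by (simp add: eintegral_def)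
  qed
  finally show ?thesis by simp
qed

lemma inner_B_matrix:
  assumes "design X \<xi>" "design X \<nu>" "B_exists K f \<xi> \<nu>" and g: "continuous_on X (g_function K f \<xi>)"
  shows "x \<bullet> (B_matrix K f \<xi> \<nu> *v y) = (LINT u|\<nu>. (x \<bullet> g_function K f \<xi> u) * (y \<bullet> f u))
    + x \<bullet> (Lambda_matrix K f \<xi> *v (M_matrix f \<nu> *v y))"
proof -
  let ?L = "Lambda_matrix K f \<xi>"
  \<comment> \<open>By the definition of \<open>g\<close>, this is the vector potential of
    \<open>\<xi>\<close>; its continuity follows from that of \<open>g\<close> and
    \<open>f\<close>.\<close>
  let ?G = "\<lambda>u. g_function K f \<xi> u + ?L *v f u"
  have Lf: "continuous_on X (\<lambda>u. ?L *v f u)"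
    by (rule bounded_linear.continuous_on[OF matrix_vector_mul_bounded_linear continuous_f])
  have G: "continuous_on X ?G"
    using g Lf by (intro continuous_intros)
  have M: "x \<bullet> (M_matrix f \<nu> *v y) = (LINT u|\<nu>. (x \<bullet> f u) * (y \<bullet> f u))" for x
    unfolding M_matrix_def
    by (rule inner_moment_matrix[OF assms(2) compact_X continuous_f continuous_f, symmetric])
  have "B_matrix K f \<xi> \<nu> = (\<chi> i j. LINT u|\<nu>. ?G u $ i * f u $ j)"
    by (simp add: vec_eq_iff B_matrix_potential[OF assms(1-3)] g_function_def)
  then have "x \<bullet> (B_matrix K f \<xi> \<nu> *v y) = (LINT u|\<nu>. (x \<bullet> ?G u) * (y \<bullet> f u))"
    by (simp only: inner_moment_matrix[OF assms(2) compact_X G continuous_f])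
  also have "\<dots> = (LINT u|\<nu>. (x \<bullet> g_function K f \<xi> u) * (y \<bullet> f u) + (x \<bullet> (?L *v f u)) * (y \<bullet> f u))"
    by (simp add: algebra_simps)
  also have "\<dots> = (LINT u|\<nu>. (x \<bullet> g_function K f \<xi> u) * (y \<bullet> f u))
      + (LINT u|\<nu>. (x \<bullet> (?L *v f u)) * (y \<bullet> f u))"
    using g Lf continuous_f
    by (intro Bochner_Integration.integral_add design_integrable_continuous[OF assms(2) compact_X]
        continuous_intros)
  also have "(LINT u|\<nu>. (x \<bullet> (?L *v f u)) * (y \<bullet> f u)) = x \<bullet> (?L *v (M_matrix f \<nu> *v y))"
    by (simp only: M dot_lmul_matrix[of x ?L, symmetric])
  finally show ?thesis .
qed

end


subsection \<open>Universal optimality\<close>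

context regression_model
begin

section \<open>Sufficiency of a vanishing \<open>g\<close>\<close>

lemma D_matrix_symmetric:
  assumes "\<xi> \<in> admissible_designs X K f"
  shows "transpose (D_matrix K f \<xi>) = D_matrix K f \<xi>"
  using assms
  by (simp add: admissible_designs_def D_matrix_def matrix_transpose_mul B_matrix_symmetric
      transpose_matrix_inv M_matrix_symmetric matrix_mul_assoc)

lemma universally_optimal_if_g_zero:
  assumes adm: "\<xi> \<in> admissible_designs X K f" and g: "g_exists X K f \<xi>"
    and zero: "\<And>x. x \<in> X \<Longrightarrow> g_function K f \<xi> x = 0"
  shows "universally_optimal X K f \<xi>"
  unfolding universally_optimal_def
proof (intro conjI ballI adm)
  fix \<nu> assume adm': "\<nu> \<in> admissible_designs X K f"
  have \<xi>: "design X \<xi>" "B_exists K f \<xi> \<xi>" "invertible (M_matrix f \<xi>)"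
    and \<nu>: "design X \<nu>" "B_exists K f \<nu> \<nu>" "invertible (M_matrix f \<nu>)"
    using adm adm' by (auto simp: admissible_designs_def)
  have mixed: "B_exists K f \<xi> \<nu>"
    by (rule B_exists_mixed[OF \<xi>(1) \<nu>(1) \<xi>(2) \<nu>(2) g])
  show "loewner_le (D_matrix K f \<xi>) (D_matrix K f \<nu>)"
    unfolding loewner_le_def
  proof (intro conjI allI)
    show "transpose (D_matrix K f \<nu> - D_matrix K f \<xi>) = D_matrix K f \<nu> - D_matrix K f \<xi>"
      using D_matrix_symmetric[OF adm] D_matrix_symmetric[OF adm']
      by (simp add: transpose_def vec_eq_iff)
  next
    fix z
    let ?L = "Lambda_matrix K f \<xi>"
    \<comment> \<open>With these choices \<open>M(\<xi>) x\<close> and \<open>M(\<nu>) y\<close>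
      both equal \<open>z\<close>, so after \<open>g\<close> drops out both energies below reduce to
      \<open>x \<bullet> (?L *v z)\<close>.\<close>
    define x where "x = matrix_inv (M_matrix f \<xi>) *v z"
    define y where "y = matrix_inv (M_matrix f \<nu>) *v z"
    have "continuous_on X (g_function K f \<xi>)"
      using zero by (rule continuous_on_eq[OF continuous_on_const sym])
    moreover have "(LINT u|\<mu>. (x \<bullet> g_function K f \<xi> u) * (w \<bullet> f u)) = 0"
      if "design X \<mu>" for \<mu> w
      using that sets_eq_imp_space_eq[of \<mu> "restrict_space borel X"]
      by (subst Bochner_Integration.integral_cong[where g = "\<lambda>_. 0"])
        (auto simp: zero design_def space_restrict_space)
    ultimately have "x \<bullet> (B_matrix K f \<xi> \<xi> *v x) = x \<bullet> (?L *v z)"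
        "x \<bullet> (B_matrix K f \<xi> \<nu> *v y) = x \<bullet> (?L *v z)"
      using \<xi> \<nu> mixed by (simp_all add: inner_B_matrix x_def y_def matrix_inv_vector)
    \<comment> \<open>In the energy of the difference, twice the mixed term is subtracted; as that
      term equals the energy of \<open>x\<close>, the difference of the two energies
      remains.\<close>
    then have "0 \<le> y \<bullet> (B_matrix K f \<nu> \<nu> *v y) - x \<bullet> (B_matrix K f \<xi> \<xi> *v x)"
      using B_matrix_nonneg[OF \<xi>(1) \<nu>(1) \<xi>(2) mixed \<nu>(2), of x "- y"]
      by (simp add: linear_neg[OF matrix_vector_mul_linear])
    also have "\<dots> = z \<bullet> ((D_matrix K f \<nu> - D_matrix K f \<xi>) *v z)"
      by (simp add: matrix_vector_mult_diff_rdistrib inner_diff_right inner_D_matrix \<xi> \<nu> x_def y_def)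
    finally show "0 \<le> z \<bullet> ((D_matrix K f \<nu> - D_matrix K f \<xi>) *v z)" .
  qed
qed

section \<open>Definiteness of \<open>M\<close> and the first-order condition\<close>

lemma inner_M_matrix:
  assumes "design X \<xi>"
  shows "x \<bullet> (M_matrix f \<xi> *v y) = (LINT u|\<xi>. (x \<bullet> f u) * (y \<bullet> f u))"
  unfolding M_matrix_def
  by (rule inner_moment_matrix[OF assms compact_X continuous_f continuous_f, symmetric])

lemma M_matrix_nonneg: "design X \<xi> \<Longrightarrow> 0 \<le> x \<bullet> (M_matrix f \<xi> *v x)"
  by (simp add: inner_M_matrix)

text \<open>A vanishing quadratic form makes \<open>x \<bullet> f\<close> zero almost everywhere, so
  \<open>M(\<xi>) x\<close> is zero and invertibility gives the claim.\<close>

lemma M_matrix_definite: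
  assumes "design X \<xi>" "invertible (M_matrix f \<xi>)" "x \<bullet> (M_matrix f \<xi> *v x) = 0"
  shows "x = 0"
proof -
  have "integrable \<xi> (\<lambda>u. (x \<bullet> f u) * (x \<bullet> f u))"
    using continuous_f by (intro design_integrable_continuous[OF assms(1) compact_X] continuous_intros)
  then have ae: "AE u in \<xi>. x \<bullet> f u = 0"
    using assms(3) integral_nonneg_eq_0_iff_AE[of \<xi> "\<lambda>u. (x \<bullet> f u) * (x \<bullet> f u)"]
    by (simp add: inner_M_matrix[OF assms(1)])
  have "y \<bullet> (M_matrix f \<xi> *v x) = 0" for y
    unfolding inner_M_matrix[OF assms(1)]
    by (rule integral_eq_zero_AE) (use ae in eventually_elim, simp)
  then have "M_matrix f \<xi> *v x = 0"
    by (metis inner_eq_zero_iff)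
  then show ?thesis
    using matrix_inv_vector(2)[OF assms(2), of x] by simp
qed

text \<open>
  The inequality is the derivative at \<open>t = 0\<close> of the optimality condition along the mixtures
  \<open>(1 - t) \<xi> + t \<nu>\<close>.  Testing with \<open>z = M(\<eta>) w\<close>, which depends on \<open>t\<close>, makes the condition
  polynomial in \<open>t\<close>, so that no matrix inverse has to be differentiated.
\<close>

lemma universally_optimal_first_order:
  assumes opt: "universally_optimal X K f \<xi>" and \<nu>: "design X \<nu>" "B_exists K f \<nu> \<nu>"
    and mixed: "B_exists K f \<xi> \<nu>"
  shows "w \<bullet> (Lambda_matrix K f \<xi> *v (M_matrix f \<nu> *v w)) \<le> w \<bullet> (B_matrix K f \<xi> \<nu> *v w)"
proof -
  have \<xi>: "design X \<xi>" "B_exists K f \<xi> \<xi>" "invertible (M_matrix f \<xi>)"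
    using opt by (auto simp: universally_optimal_def admissible_designs_def)
  let ?B = "B_matrix K f \<xi> \<xi>" and ?C = "B_matrix K f \<xi> \<nu>" and ?E = "B_matrix K f \<nu> \<nu>"
  \<comment> \<open>Then \<open>M(\<xi>)\<close> inverse maps \<open>M(\<eta>) w\<close> to
    \<open>(1 - t) *\<^sub>R w + t *\<^sub>R e\<close>, which is affine in \<open>t\<close>.\<close>
  define e where "e = matrix_inv (M_matrix f \<xi>) *v (M_matrix f \<nu> *v w)"
  have "w \<bullet> (?B *v e) - w \<bullet> (?C *v w) \<le> 0"
  proof (rule nonpos_if_small_multiples)
    fix t :: real assume t: "0 < t" "t < 1"
    obtain \<eta> where \<eta>: "design X \<eta>" "B_exists K f \<eta> \<eta>"
      and M_eta: "\<And>x. M_matrix f \<eta> *v x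
        = (1 - t) *\<^sub>R (M_matrix f \<xi> *v x) + t *\<^sub>R (M_matrix f \<nu> *v x)"
      and B_eta: "\<And>x. x \<bullet> (B_matrix K f \<eta> \<eta> *v x) = (1 - t)\<^sup>2 * (x \<bullet> (?B *v x))
        + 2 * (1 - t) * t * (x \<bullet> (?C *v x)) + t\<^sup>2 * (x \<bullet> (?E *v x))"
      using mixture_design[OF \<xi>(1) \<nu>(1) \<xi>(2) mixed \<nu>(2), of t] t by auto
    \<comment> \<open>For \<open>t < 1\<close> the matrix of the mixture is a positive multiple of a
      definite matrix plus a nonnegative one, hence definite.\<close>
    have "x = 0" if "M_matrix f \<eta> *v x = 0" for x
    proof -
      have "(1 - t) * (x \<bullet> (M_matrix f \<xi> *v x)) + t * (x \<bullet> (M_matrix f \<nu> *v x)) = 0"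
        using arg_cong[OF that, of "inner x"] by (simp add: M_eta inner_add_right)
      moreover have "0 \<le> (1 - t) * (x \<bullet> (M_matrix f \<xi> *v x))" "0 \<le> t * (x \<bullet> (M_matrix f \<nu> *v x))"
        using t M_matrix_nonneg \<xi>(1) \<nu>(1) by simp_all
      ultimately have "x \<bullet> (M_matrix f \<xi> *v x) = 0"
        using t by (simp add: add_nonneg_eq_0_iff)
      then show ?thesis
        by (rule M_matrix_definite[OF \<xi>(1,3)])
    qed
    then have inv: "invertible (M_matrix f \<eta>)"
      by (simp add: invertible_left_inverse matrix_left_invertible_ker)
    define z where "z = M_matrix f \<eta> *v w"
    have "\<eta> \<in> admissible_designs X K f"
      using \<eta> inv by (simp add: admissible_designs_def)
    then have "0 \<le> z \<bullet> ((D_matrix K f \<eta> - D_matrix K f \<xi>) *v z)"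
      using opt by (simp add: universally_optimal_def loewner_le_def)
    then have "z \<bullet> (D_matrix K f \<xi> *v z) \<le> z \<bullet> (D_matrix K f \<eta> *v z)"
      by (simp add: matrix_vector_mult_diff_rdistrib inner_diff_right)
    moreover have "matrix_inv (M_matrix f \<xi>) *v z = (1 - t) *\<^sub>R w + t *\<^sub>R e"
      by (simp add: z_def M_eta e_def matrix_vector_right_distrib matrix_vector_mult_scaleR
          matrix_inv_vector \<xi>)
    moreover have "matrix_inv (M_matrix f \<eta>) *v z = w"
      by (simp add: z_def matrix_inv_vector inv)
    ultimately have le: "((1 - t) *\<^sub>R w + t *\<^sub>R e) \<bullet> (?B *v ((1 - t) *\<^sub>R w + t *\<^sub>R e))
        \<le> w \<bullet> (B_matrix K f \<eta> \<eta> *v w)"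
      by (simp add: inner_D_matrix \<xi> inv)
    have sym: "e \<bullet> (?B *v w) = w \<bullet> (?B *v e)"
      using inner_symmetric_matrix[OF B_matrix_symmetric[OF \<xi>(1)], of e w] by (simp add: inner_commute)
    have "(1 - t)\<^sup>2 * (w \<bullet> (?B *v w)) + 2 * (1 - t) * t * (w \<bullet> (?B *v e)) + t\<^sup>2 * (e \<bullet> (?B *v e))
        \<le> (1 - t)\<^sup>2 * (w \<bullet> (?B *v w)) + 2 * (1 - t) * t * (w \<bullet> (?C *v w)) + t\<^sup>2 * (w \<bullet> (?E *v w))"
      using le unfolding B_eta
      by (simp add: matrix_vector_right_distrib matrix_vector_mult_scaleR inner_add_left
          inner_add_right sym power2_eq_square algebra_simps)
    \<comment> \<open>The terms with factor \<open>(1 - t)\<^sup>2\<close> agree on both sides and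
      cancel; what remains is divisible by \<open>2 * t\<close>.\<close>
    then have "t * ((1 - t) * (w \<bullet> (?B *v e) - w \<bullet> (?C *v w)))
        \<le> t * (t * ((w \<bullet> (?E *v w) - e \<bullet> (?B *v e)) / 2))"
      by (simp add: power2_eq_square algebra_simps)
    then show "(1 - t) * (w \<bullet> (?B *v e) - w \<bullet> (?C *v w))
        \<le> t * ((w \<bullet> (?E *v w) - e \<bullet> (?B *v e)) / 2)"
      using t(1) by (simp only: mult_le_cancel_left_pos)
  qed
  then show ?thesis
    by (simp add: e_def Lambda_matrix_def matrix_vector_mul_assoc[symmetric])
qed

section \<open>From integral conditions to pointwise conditions\<close>

lemma locally_chargeable_finite_kernel:
  assumes "finite_kernel X K"
  shows "locally_chargeable X K f"
  unfolding locally_chargeable_def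
proof (intro ballI allI impI, elim conjE)
  fix x U assume x: "x \<in> X" and U: "open U" "x \<in> U"
  let ?S = "restrict_space borel X"
  define \<nu> where "\<nu> = return ?S x"
  have "x \<in> space ?S"
    using x by (simp add: space_restrict_space)
  then have \<nu>: "design X \<nu>"
    by (simp add: design_def \<nu>_def prob_space_return)
  interpret kernel_on_space X K \<nu>
    by (rule kernel_on_space_design[OF covariance \<nu>])
  have f: "integrable \<nu> (\<lambda>u. f u $ i)" for i
    using continuous_f by (intro design_integrable_continuous[OF \<nu> compact_X] continuous_intros)
  \<comment> \<open>The factor 1 presents the point mass as a density with respect to itself, the
    form the energy lemmas require.\<close>
  then have "kernel_integrable (\<lambda>u. (1 *\<^sub>R f u) $ i) (\<lambda>u. (1 *\<^sub>R f u) $ j)" for i j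
    using assms by (intro kernel_integrable_finite_kernel) auto
  then have "B_exists K f \<nu> \<nu>"
    using B_exists_density_iff[of "\<lambda>_. 1" "\<lambda>_. 1" f] f by (simp add: density_1 finite_measure_axioms)
  moreover have "U \<inter> X \<in> sets ?S"
    using U(1) by (subst Int_commute) (simp add: sets_restrict_space)
  then have "emeasure \<nu> (U \<inter> X) = 1"
    using x U(2) by (simp add: \<nu>_def emeasure_return)
  ultimately show "\<exists>\<nu>. design X \<nu> \<and> B_exists K f \<nu> \<nu> \<and> emeasure \<nu> (U \<inter> X) = 1"
    using \<nu> by blast
qed

text \<open>If \<open>h x\<close> were negative, \<open>h\<close> would stay below
  \<open>h x / 2\<close> on a neighbourhood of \<open>x\<close>, and a design concentrated there
  would have a negative integral.\<close>

lemma locally_chargeable_nonneg: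
  fixes h :: "'a \<Rightarrow> real"
  assumes chargeable: "locally_chargeable X K f" and h: "continuous_on X h"
    and nonneg: "\<And>\<nu>. design X \<nu> \<Longrightarrow> B_exists K f \<nu> \<nu> \<Longrightarrow> 0 \<le> (LINT u|\<nu>. h u)"
    and x: "x \<in> X"
  shows "0 \<le> h x"
proof (rule ccontr)
  assume "\<not> 0 \<le> h x"
  then have hx: "h x < h x / 2" "h x / 2 < 0" by auto
  obtain U where U: "open U" "U \<inter> X = h -` {..<h x / 2} \<inter> X"
    using h open_lessThan[of "h x / 2"] unfolding continuous_on_open_invariant by blast
  then have "x \<in> U"
    using x hx(1) by auto
  then obtain \<nu> where \<nu>: "design X \<nu>" "B_exists K f \<nu> \<nu>" "emeasure \<nu> (U \<inter> X) = 1"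
    using chargeable x U(1) unfolding locally_chargeable_def by blast
  interpret prob_space \<nu>
    using \<nu>(1) by (simp add: design_def)
  have "AE u in \<nu>. u \<in> U \<inter> X"
    using \<nu>(3) by (intro AE_prob_1) (simp add: measure_def)
  then have "AE u in \<nu>. h u \<le> h x / 2"
    by eventually_elim (use U(2) in auto)
  then have "(LINT u|\<nu>. h u) \<le> (LINT u|\<nu>. h x / 2)"
    by (intro integral_mono_AE design_integrable_continuous[OF \<nu>(1) compact_X h]) auto
  then show False
    using nonneg[OF \<nu>(1,2)] hx(2) by (simp add: prob_space)
qed

text \<open>A nonnegative function with zero integral vanishes almost everywhere, whereas a positive
  value at \<open>x\<close> persists on a neighbourhood, which has positive mass when
  \<open>x\<close> lies in the support.\<close>

lemma design_support_zero:
  fixes h :: "'a \<Rightarrow> real"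
  assumes "design X \<xi>" and h: "continuous_on X h" "\<And>x. x \<in> X \<Longrightarrow> 0 \<le> h x"
    and zero: "(LINT u|\<xi>. h u) = 0" and x: "x \<in> design_support X \<xi>"
  shows "h x = 0"
proof (rule ccontr)
  assume "h x \<noteq> 0"
  moreover have "x \<in> X"
    using x by (simp add: design_support_def)
  ultimately have hx: "0 < h x"
    using h(2) by force
  have sets: "sets \<xi> = sets (restrict_space borel X)"
    using assms(1) by (simp add: design_def)
  have space: "space \<xi> = X"
    using sets_eq_imp_space_eq[OF sets] by (simp add: space_restrict_space)
  obtain U where U: "open U" "U \<inter> X = h -` {0<..} \<inter> X"
    using h(1) open_greaterThan[of "0::real"] unfolding continuous_on_open_invariant by blast
  then have "x \<in> U"
    using hx \<open>x \<in> X\<close> by auto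
  then have "0 < emeasure \<xi> (U \<inter> X)"
    using x U(1) unfolding design_support_def by blast
  moreover have "AE u in \<xi>. u \<notin> U \<inter> X"
  proof -
    have "AE u in \<xi>. h u = 0"
      using zero design_integrable_continuous[OF assms(1) compact_X h(1)] h(2)
      by (subst (asm) integral_nonneg_eq_0_iff_AE) (auto simp: space)
    then show ?thesis
      by eventually_elim (use U(2) in auto)
  qed
  moreover have "U \<inter> X \<in> sets \<xi>"
    using U(1) by (subst Int_commute) (simp add: sets sets_restrict_space)
  ultimately show False
    using AE_iff_null_sets[of "U \<inter> X" \<xi>] by (simp add: null_sets_def)
qed

lemma g_proportional_if_universally_optimal:
  assumes opt: "universally_optimal X K f \<xi>"
    and g_ex: "g_exists X K f \<xi>" and g: "continuous_on X (g_function K f \<xi>)"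
    and chargeable: "locally_chargeable X K f" and f_nz: "\<And>x. x \<in> X \<Longrightarrow> f x \<noteq> 0"
  shows "\<exists>\<gamma>. (\<forall>x\<in>X. 0 \<le> \<gamma> x \<and> g_function K f \<xi> x = \<gamma> x *\<^sub>R f x)
    \<and> (\<forall>x\<in>design_support X \<xi>. \<gamma> x = 0)"
proof -
  let ?g = "g_function K f \<xi>"
  have \<xi>: "design X \<xi>" "B_exists K f \<xi> \<xi>" "invertible (M_matrix f \<xi>)"
    using opt by (auto simp: universally_optimal_def admissible_designs_def)
  have same_sign: "0 \<le> (w \<bullet> ?g x) * (w \<bullet> f x)" if "x \<in> X" for w x
  proof (rule locally_chargeable_nonneg[OF chargeable _ _ that])
    show "continuous_on X (\<lambda>x. (w \<bullet> ?g x) * (w \<bullet> f x))"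
      using g continuous_f by (intro continuous_intros)
    fix \<nu> assume \<nu>: "design X \<nu>" "B_exists K f \<nu> \<nu>"
    have mixed: "B_exists K f \<xi> \<nu>"
      by (rule B_exists_mixed[OF \<xi>(1) \<nu>(1) \<xi>(2) \<nu>(2) g_ex])
    show "0 \<le> (LINT u|\<nu>. (w \<bullet> ?g u) * (w \<bullet> f u))"
      using universally_optimal_first_order[OF opt \<nu> mixed, of w]
      by (simp add: inner_B_matrix[OF \<xi>(1) \<nu>(1) mixed g])
  qed
  \<comment> \<open>The coefficient of the orthogonal projection of \<open>g\<close> onto
    \<open>f\<close>.\<close>
  define \<gamma> where "\<gamma> x = ?g x \<bullet> f x / (f x \<bullet> f x)" for x
  have \<gamma>: "0 \<le> \<gamma> x" "?g x = \<gamma> x *\<^sub>R f x" if "x \<in> X" for x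
    unfolding \<gamma>_def
    by (rule collinear_if_inner_products_same_sign[OF f_nz[OF that] same_sign[OF that]])+
  have gf_cont: "continuous_on X (\<lambda>x. ?g x \<bullet> f x)"
    using g continuous_f by (intro continuous_intros)
  \<comment> \<open>Taking \<open>\<nu> = \<xi>\<close>, the identity
    \<open>\<Lambda> M(\<xi>) = B(\<xi>, \<xi>)\<close> kills the diagonal entries. Their sum is the
    integral of \<open>g \<bullet> f\<close>, a continuous nonnegative function that vanishes on the
    support, and with it \<open>\<gamma>\<close>.\<close>
  have "(LINT u|\<xi>. (axis i 1 \<bullet> ?g u) * (axis i 1 \<bullet> f u)) = 0" for i
    using inner_B_matrix[OF \<xi>(1) \<xi>(1,2) g, of "axis i 1" "axis i 1"] Lambda_M_matrix[OF \<xi>(3), of K]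
    by (simp add: matrix_vector_mul_assoc)
  then have zero: "(LINT u|\<xi>. ?g u $ i * f u $ i) = 0" for i
    by (simp add: inner_axis' inner_real_def)
  have int0: "(LINT u|\<xi>. ?g u \<bullet> f u) = 0"
    unfolding inner_vec_def inner_real_def using zero g continuous_f
    by (subst Bochner_Integration.integral_sum)
      (auto intro!: design_integrable_continuous[OF \<xi>(1) compact_X] continuous_intros)
  have gf_nn: "0 \<le> ?g x \<bullet> f x" if "x \<in> X" for x
    using \<gamma>[OF that] by simp
  have "\<gamma> x = 0" if "x \<in> design_support X \<xi>" for x
    using design_support_zero[OF \<xi>(1) gf_cont gf_nn int0 that] by (simp add: \<gamma>_def)
  then show ?thesis
    using \<gamma> by blast
qed

end

theorem theorem3p3:
  fixes X :: "(real ^ 'd) set"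
    and f :: "real ^ 'd \<Rightarrow> real ^ 'm"
    and K :: "real ^ 'd \<Rightarrow> real ^ 'd \<Rightarrow> ereal"
    and \<xi> :: "(real ^ 'd) measure"
  assumes "compact X"
    and "continuous_on X f"
    and "linearly_independent_on X f"
    and "\<forall>x\<in>X. f x \<noteq> 0"
    and "covariance_kernel X K"
    and "\<xi> \<in> admissible_designs X K f"
    and "g_exists X K f \<xi>"
    and "continuous_on X (g_function K f \<xi>)"
  shows "((\<forall>x\<in>X. g_function K f \<xi> x = 0) \<longrightarrow> universally_optimal X K f \<xi>) \<and>
         ((singular_kernel X K \<longrightarrow> locally_chargeable X K f) \<longrightarrow>
          universally_optimal X K f \<xi> \<longrightarrow>
          (\<exists>\<gamma> :: real ^ 'd \<Rightarrow> real.
             (\<forall>x\<in>X. 0 \<le> \<gamma> x \<and> g_function K f \<xi> x = \<gamma> x *\<^sub>R f x) \<and>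
             (\<forall>x\<in>design_support X \<xi>. \<gamma> x = 0)))"
proof -
  interpret regression_model X f K
    using assms by unfold_locales
  have "finite_kernel X K \<or> singular_kernel X K"
    using assms by (simp add: covariance_kernel_def)
  \<comment> \<open>Point masses give chargeability for finite kernels; for singular ones it is the
    premise.\<close>
  then have "locally_chargeable X K f" if "singular_kernel X K \<longrightarrow> locally_chargeable X K f"
    using that locally_chargeable_finite_kernel by blast
  then show ?thesis
    using assms universally_optimal_if_g_zero[of \<xi>] g_proportional_if_universally_optimal[of \<xi>]
    by blast
qed

end
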